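(* Let $G$ be a finite planar graph with no two intersecting triangles and such that every triangle of $G$ is adjacent to at most one $4$-cycle. Then $G$ is adaptably $3$-choosable (i.e. $\mathrm{ch}_{ad}(G)\le 3$), and hence $G$ is $(3,1)$-choosable.
   Context: A triangle is a $3$-cycle. Two cycles are adjacent if they share a common edge, and intersecting if they have at least one common vertex. Given a (possibly improper) edge coloring $F$ of $G$ with integers, a vertex coloring $c$ is adapted to $F$ if no edge $uv$ satisfies $c(u)=c(v)=F(uv)$. $G$ is adaptably $k$-choosable if for every edge coloring $F$ and every list assignment $L$ with $|L(v)|\ge k$ for all $v$, there is a coloring $c$ adapted to $F$ with $c(v)\in L(v)$ for all $v$; $\mathrm{ch}_{ad}(G)$ is the least such $k$. A $(k,d)$-list assignment assigns to each vertex a list of at least $k$ colors such that adjacent vertices' lists share at most $d$ colors; $G$ is $(k,d)$-choosable if for every such assignment $L$ there is a proper vertex coloring from the lists. *)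

theory Defs
  imports "HOL-Analysis.Analysis"
begin

definition simple_graph :: "'a set \<Rightarrow> 'a set set \<Rightarrow> bool" where
  "simple_graph V E \<longleftrightarrow> finite V \<and>
     (\<forall>e\<in>E. \<exists>u v. e = {u, v} \<and> u \<noteq> v \<and> u \<in> V \<and> v \<in> V)"

definition planar_graph :: "'a set \<Rightarrow> 'a set set \<Rightarrow> bool" where
  "planar_graph V E \<longleftrightarrow>
     (\<exists>(p :: 'a \<Rightarrow> complex) (\<gamma> :: 'a set \<Rightarrow> real \<Rightarrow> complex).
        inj_on p V \<and>
        (\<forall>e\<in>E. arc (\<gamma> e) \<and> {pathstart (\<gamma> e), pathfinish (\<gamma> e)} = p ` e \<and>
                path_image (\<gamma> e) \<inter> p ` V = p ` e) \<and>
        (\<forall>e1\<in>E. \<forall>e2\<in>E. e1 \<noteq> e2 \<longrightarrow>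
                path_image (\<gamma> e1) \<inter> path_image (\<gamma> e2) \<subseteq> p ` (e1 \<inter> e2)))"

definition cycle_edges :: "'a list \<Rightarrow> 'a set set" where
  "cycle_edges vs = {{vs ! i, vs ! ((i + 1) mod length vs)} | i. i < length vs}"

definition is_cycle :: "'a set \<Rightarrow> 'a set set \<Rightarrow> nat \<Rightarrow> 'a set set \<Rightarrow> bool" where
  "is_cycle V E k C \<longleftrightarrow>
     (\<exists>vs. length vs = k \<and> 3 \<le> k \<and> distinct vs \<and> set vs \<subseteq> V \<and>
           C = cycle_edges vs \<and> C \<subseteq> E)"

abbreviation triangle :: "'a set \<Rightarrow> 'a set set \<Rightarrow> 'a set set \<Rightarrow> bool" where
  "triangle V E C \<equiv> is_cycle V E 3 C"

definition cycle_vertices :: "'a set set \<Rightarrow> 'a set" where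
  "cycle_vertices C = \<Union>C"

definition adjacent_cycles :: "'a set set \<Rightarrow> 'a set set \<Rightarrow> bool" where
  "adjacent_cycles C D \<longleftrightarrow> C \<inter> D \<noteq> {}"

definition intersecting_cycles :: "'a set set \<Rightarrow> 'a set set \<Rightarrow> bool" where
  "intersecting_cycles C D \<longleftrightarrow> cycle_vertices C \<inter> cycle_vertices D \<noteq> {}"

definition adapted :: "'a set set \<Rightarrow> ('a set \<Rightarrow> int) \<Rightarrow> ('a \<Rightarrow> int) \<Rightarrow> bool" where
  "adapted E F c \<longleftrightarrow> (\<forall>u v. {u, v} \<in> E \<longrightarrow> \<not> (c u = F {u, v} \<and> c v = F {u, v}))"

definition adaptably_choosable :: "'a set \<Rightarrow> 'a set set \<Rightarrow> nat \<Rightarrow> bool" where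
  "adaptably_choosable V E k \<longleftrightarrow>
     (\<forall>(F :: 'a set \<Rightarrow> int) (L :: 'a \<Rightarrow> int set).
        (\<forall>v\<in>V. finite (L v) \<and> k \<le> card (L v)) \<longrightarrow>
        (\<exists>c. adapted E F c \<and> (\<forall>v\<in>V. c v \<in> L v)))"

definition kd_list_assignment :: "'a set \<Rightarrow> 'a set set \<Rightarrow> nat \<Rightarrow> nat \<Rightarrow> ('a \<Rightarrow> int set) \<Rightarrow> bool" where
  "kd_list_assignment V E k d L \<longleftrightarrow>
     (\<forall>v\<in>V. finite (L v) \<and> k \<le> card (L v)) \<and>
     (\<forall>u v. {u, v} \<in> E \<longrightarrow> card (L u \<inter> L v) \<le> d)"

definition proper_colouring :: "'a set set \<Rightarrow> ('a \<Rightarrow> int) \<Rightarrow> bool" where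
  "proper_colouring E c \<longleftrightarrow> (\<forall>u v. {u, v} \<in> E \<longrightarrow> u \<noteq> v \<longrightarrow> c u \<noteq> c v)"

definition kd_choosable :: "'a set \<Rightarrow> 'a set set \<Rightarrow> nat \<Rightarrow> nat \<Rightarrow> bool" where
  "kd_choosable V E k d \<longleftrightarrow>
     (\<forall>L. kd_list_assignment V E k d L \<longrightarrow>
        (\<exists>c. proper_colouring E c \<and> (\<forall>v\<in>V. c v \<in> L v)))"

end

theory Submission
  imports Defs
begin

text \<open>
  If every edge can be assigned to one of its endpoints so that no vertex receives more than two
  edges, then colouring each vertex by a list colour different from the (at most two) colours of its
  own edges is adapted. By Hakimi's criterion such an assignment exists once every vertex set
  \<open>X\<close> spans at most \<open>2 * card X\<close> edges, and as the hypotheses are hereditary it suffices to bound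
  \<open>card E\<close>. A minimal counterexample is 2-connected with minimum degree 3, and Euler's formula
  reduces the bound to the claim that the face lengths average at least 4. Each triangular face has
  at least two edges whose other side is a face of length at least 5, and takes charge 1/2
  across each of these. As triangles are disjoint and no vertex has degree 2, the edges across
  which a face of length \<open>d \<ge> 5\<close> pays form a matching on its boundary, so it pays at most
  \<open>\<lfloor>d/2\<rfloor>/2 \<le> d - 4\<close>.

  The faces are obtained from the Jordan curve theorem: given a cycle \<open>C\<close> with something drawn
  inside, 2-connectedness yields a path inside \<open>C\<close> joining two of its vertices, the theta-curve
  theorem splits the inside in two, and one recurses. An inversion centred inside \<open>C\<close> exchanges
  the two sides, so the outside of \<open>C\<close> is handled by the same statement.
\<close>

section \<open>Paths and circuits\<close>

primrec path_via :: "'a \<Rightarrow> 'a list \<Rightarrow> 'a \<Rightarrow> 'a set set" where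
  "path_via a [] b = {{a, b}}"
| "path_via a (x # xs) b = insert {a, x} (path_via x xs b)"

lemma path_via_append: "path_via a (xs @ y # ys) b = path_via a xs y \<union> path_via y ys b"
  by (induction xs arbitrary: a) auto

lemma path_via_rev: "path_via a (rev xs) b = path_via b xs a"
  by (induction xs arbitrary: b) (auto simp: path_via_append insert_commute)

lemma Union_path_via [simp]: "\<Union>(path_via a xs b) = {a, b} \<union> set xs"
  by (induction xs arbitrary: a) auto

lemma finite_path_via [simp]: "finite (path_via a xs b)"
  by (induction xs arbitrary: a) auto

lemma path_via_nonempty [simp]: "path_via a xs b \<noteq> {}"
  by (cases xs) auto

lemma card_edge_path_via: "distinct (a # xs @ [b]) \<Longrightarrow> e \<in> path_via a xs b \<Longrightarrow> card e = 2"
  by (induction xs arbitrary: a) auto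

lemma card_path_via: "distinct (a # xs @ [b]) \<Longrightarrow> card (path_via a xs b) = Suc (length xs)"
proof (induction xs arbitrary: a)
  case (Cons x xs)
  have "{a, x} \<notin> path_via x xs b"
    using Cons.prems Union_upper[of "{a, x}" "path_via x xs b"] by auto
  then show ?case using Cons by simp
qed simp

lemma path_via_edge_subset_ends:
  assumes "distinct (a # xs @ [b])" "e \<in> path_via a xs b" "e \<subseteq> {a, b}"
  shows "xs = []"
proof (cases xs)
  case (Cons x xs')
  then have "e \<in> path_via x xs' b" using assms by auto
  then have "e \<subseteq> {b}" "card e = 2"
    using Union_upper[of e "path_via x xs' b"] card_edge_path_via[OF assms(1,2)] assms Cons by auto
  then show ?thesis using card_mono[of "{b}" e] by simp
qed simp

lemma path_via_Int_empty:
  assumes "distinct (a # xs @ [b])" "xs \<noteq> []" "set xs \<inter> \<Union>D = {}"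
  shows "path_via a xs b \<inter> D = {}"
proof (rule equals0I)
  fix e assume e: "e \<in> path_via a xs b \<inter> D"
  then have "e \<subseteq> {a, b}" using Union_upper[of e "path_via a xs b"] assms(3) by auto
  then show False using path_via_edge_subset_ends[OF assms(1)] e assms(2) by blast
qed

lemma path_via_disjoint:
  assumes "distinct (a # b # xs @ ys)"
  shows "path_via a xs b \<inter> path_via a ys b = {} \<longleftrightarrow> xs \<noteq> [] \<or> ys \<noteq> []"
  using assms path_via_Int_empty[of a xs b "path_via a ys b"]
    path_via_Int_empty[of a ys b "path_via a xs b"]
  by (cases "xs = []"; cases "ys = []") auto

lemma path_via_incident_start:
  assumes "distinct (a # xs @ [b])"
  shows "{e \<in> path_via a xs b. a \<in> e} = {{a, hd (xs @ [b])}}"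
proof (cases xs)
  case (Cons x xs')
  have "a \<notin> e" if "e \<in> path_via x xs' b" for e
    using Union_upper[OF that] assms Cons by auto
  then show ?thesis using Cons by auto
qed auto

lemma path_via_nth:
  "path_via a xs b = (\<lambda>i. {(a # xs @ [b]) ! i, (xs @ [b]) ! i}) ` {..<Suc (length xs)}"
proof (induction xs arbitrary: a)
  case (Cons x xs)
  then show ?case
    by (simp add: lessThan_Suc_eq_insert_0[of "Suc (length xs)"] image_image)
qed (auto simp: lessThan_Suc)

definition circuit :: "'a set set \<Rightarrow> bool" where
  "circuit C \<longleftrightarrow> (\<exists>a zs. distinct (a # zs) \<and> 2 \<le> length zs \<and> C = path_via a zs a)"

lemma circuit_Un_path_via:
  assumes "distinct (a # b # xs @ ys)" "path_via a xs b \<inter> path_via a ys b = {}"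
  shows "circuit (path_via a xs b \<union> path_via a ys b)"
proof -
  have "path_via a (xs @ b # rev ys) a = path_via a xs b \<union> path_via a ys b"
    by (simp add: path_via_append path_via_rev)
  moreover have "2 \<le> length (xs @ b # rev ys)"
    using assms path_via_disjoint[OF assms(1)] by (cases xs; cases ys) auto
  moreover have "distinct (a # xs @ b # rev ys)" using assms(1) by auto
  ultimately show ?thesis unfolding circuit_def by metis
qed

lemma circuit_rotate:
  assumes "circuit C" "y \<in> \<Union>C"
  obtains zs where "distinct (y # zs)" "2 \<le> length zs" "C = path_via y zs y"
proof -
  obtain a zs where C: "distinct (a # zs)" "2 \<le> length zs" "C = path_via a zs a"
    using assms unfolding circuit_def by blast
  show thesis
  proof (cases "y = a")
    case False
    then obtain l r where zs: "zs = l @ y # r" using assms(2) C(3) by (auto dest: split_list)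
    have "C = path_via y (r @ a # l) y" using C(3) zs by (auto simp: path_via_append)
    then show thesis using that[of "r @ a # l"] C zs by auto
  qed (use that C in blast)
qed

lemma circuit_split:
  assumes "circuit C" "u \<in> \<Union>C" "v \<in> \<Union>C" "u \<noteq> v"
  obtains xs ys where "distinct (u # v # xs @ ys)" "path_via u xs v \<inter> path_via u ys v = {}"
    "C = path_via u xs v \<union> path_via u ys v"
proof -
  obtain zs where C: "distinct (u # zs)" "2 \<le> length zs" "C = path_via u zs u"
    using circuit_rotate[OF assms(1,2)] .
  obtain l r where zs: "zs = l @ v # r" using assms(3,4) C(3) by (auto dest: split_list)
  have "distinct (u # v # l @ rev r)" "l \<noteq> [] \<or> rev r \<noteq> []" using C(1,2) zs by auto
  moreover have "C = path_via u l v \<union> path_via u (rev r) v"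
    using C(3) zs by (simp add: path_via_append path_via_rev)
  ultimately show thesis using that path_via_disjoint by metis
qed

lemma circuit_other_vertex:
  assumes "circuit C"
  obtains s where "s \<in> \<Union>C" "s \<noteq> u"
proof -
  obtain a zs where C: "distinct (a # zs)" "2 \<le> length zs" "C = path_via a zs a"
    using assms unfolding circuit_def by blast
  then have "hd zs \<in> \<Union>C" "hd zs \<noteq> a" by (cases zs; auto)+
  then show thesis using that[of a] that[of "hd zs"] C(3) by (cases "a = u") auto
qed

lemma circuit_two_paths:
  assumes "circuit C"
  obtains a b xs ys where "distinct (a # b # xs @ ys)"
    "path_via a xs b \<inter> path_via a ys b = {}" "C = path_via a xs b \<union> path_via a ys b"
proof -
  obtain a where a: "a \<in> \<Union>C" using circuit_other_vertex[OF assms] .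
  obtain b where b: "b \<in> \<Union>C" "b \<noteq> a" using circuit_other_vertex[OF assms] .
  show thesis using circuit_split[OF assms a b(1)] b(2) that by metis
qed

lemma circuit_finite: "circuit C \<Longrightarrow> finite C" "circuit C \<Longrightarrow> finite (\<Union>C)"
  by (auto simp: circuit_def)

lemma circuit_card:
  assumes "circuit C"
  shows "card (\<Union>C) = card C" "3 \<le> card C"
proof -
  obtain a b xs ys where C: "distinct (a # b # xs @ ys)"
      "path_via a xs b \<inter> path_via a ys b = {}" "C = path_via a xs b \<union> path_via a ys b"
    using circuit_two_paths[OF assms] .
  have "\<Union>C = set (a # b # xs @ ys)" using C(3) by auto
  then have vertices: "card (\<Union>C) = 2 + length xs + length ys"
    using distinct_card[OF C(1)] by simp
  have "card C = card (path_via a xs b) + card (path_via a ys b)"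
    unfolding C(3) by (rule card_Un_disjoint[OF _ _ C(2)]) auto
  then have edges: "card C = 2 + length xs + length ys"
    using C(1) by (simp add: card_path_via)
  show "card (\<Union>C) = card C" using vertices edges by simp
  have "xs \<noteq> [] \<or> ys \<noteq> []" using path_via_disjoint[OF C(1)] C(2) by simp
  then show "3 \<le> card C" using edges by (cases xs; cases ys) auto
qed

lemma circuit_incident:
  assumes "circuit C" "y \<in> \<Union>C"
  shows "card {e \<in> C. y \<in> e} = 2"
proof -
  obtain v where v: "v \<in> \<Union>C" "v \<noteq> y" using circuit_other_vertex[OF assms(1)] .
  obtain xs ys where C: "distinct (y # v # xs @ ys)" "path_via y xs v \<inter> path_via y ys v = {}"
      "C = path_via y xs v \<union> path_via y ys v"
    using circuit_split[OF assms v(1)] v(2) by metis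
  have "{e \<in> C. y \<in> e} = {e \<in> path_via y xs v. y \<in> e} \<union> {e \<in> path_via y ys v. y \<in> e}"
    unfolding C(3) by blast
  also have "card \<dots> = card {e \<in> path_via y xs v. y \<in> e} + card {e \<in> path_via y ys v. y \<in> e}"
    using C(2) by (intro card_Un_disjoint) auto
  also have "\<dots> = 2" using C(1) by (simp add: path_via_incident_start)
  finally show ?thesis .
qed

lemma circuit_incident_eq:
  assumes "circuit C" "e1 \<in> C" "e2 \<in> C" "e1 \<noteq> e2" "y \<in> e1 \<inter> e2"
  shows "{e \<in> C. y \<in> e} = {e1, e2}"
proof (rule card_subset_eq[symmetric])
  show "finite {e \<in> C. y \<in> e}" using circuit_finite(1)[OF assms(1)] by simp
  show "{e1, e2} \<subseteq> {e \<in> C. y \<in> e}" using assms by auto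
  have "y \<in> \<Union>C" using assms by auto
  then show "card {e1, e2} = card {e \<in> C. y \<in> e}"
    using circuit_incident[OF assms(1)] assms(4) by simp
qed

lemma cycle_edges_Cons: "cycle_edges (a # zs) = path_via a zs a"
proof -
  have "cycle_edges (a # zs)
      = (\<lambda>i. {(a # zs) ! i, (a # zs) ! ((i + 1) mod length (a # zs))}) ` {..<length (a # zs)}"
    unfolding cycle_edges_def by blast
  also have "\<dots> = path_via a zs a"
    unfolding path_via_nth
  proof (rule image_cong)
    fix i assume "i \<in> {..<Suc (length zs)}"
    then have "i < Suc (length zs)" by simp
    then have "(zs @ [a]) ! i = (a # zs) ! ((i + 1) mod length (a # zs))"
      by (cases "i = length zs") (simp_all add: nth_append)
    moreover have "(a # zs @ [a]) ! i = (a # zs) ! i"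
      using \<open>i < Suc (length zs)\<close> nth_append[of "a # zs" "[a]" i] by simp
    ultimately show "{(a # zs) ! i, (a # zs) ! ((i + 1) mod length (a # zs))}
        = {(a # zs @ [a]) ! i, (zs @ [a]) ! i}" by (simp only:)
  qed simp
  finally show ?thesis .
qed

lemma is_cycle_iff_circuit: "is_cycle V E k C \<longleftrightarrow> circuit C \<and> C \<subseteq> E \<and> \<Union>C \<subseteq> V \<and> card C = k"
proof
  assume "is_cycle V E k C"
  then obtain vs where vs: "length vs = k" "3 \<le> k" "distinct vs" "set vs \<subseteq> V"
      "C = cycle_edges vs" "C \<subseteq> E"
    unfolding is_cycle_def by blast
  then obtain a zs where cyc: "vs = a # zs" by (cases vs) auto
  have C: "C = path_via a zs a" using vs(5) cyc by (simp add: cycle_edges_Cons)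
  have circ: "circuit C"
    unfolding circuit_def by (intro exI[of _ a] exI[of _ zs]) (use vs(1-3) cyc C in auto)
  have "\<Union>C = set vs" unfolding C cyc by simp
  moreover from this have "card C = k"
    using circuit_card(1)[OF circ] vs(1,3) by (simp add: distinct_card)
  ultimately show "circuit C \<and> C \<subseteq> E \<and> \<Union>C \<subseteq> V \<and> card C = k" using circ vs by simp
next
  assume C: "circuit C \<and> C \<subseteq> E \<and> \<Union>C \<subseteq> V \<and> card C = k"
  then obtain a zs where cyc: "distinct (a # zs)" "C = path_via a zs a"
    unfolding circuit_def by (elim conjE exE)
  have "\<Union>C = set (a # zs)" using cyc(2) by simp
  moreover from this have "length (a # zs) = k"
    using C circuit_card(1)[of C] distinct_card[OF cyc(1)] by simp
  ultimately show "is_cycle V E k C"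
    unfolding is_cycle_def
    by (intro exI[of _ "a # zs"]) (use C cyc circuit_card(2)[of C] in \<open>simp add: cycle_edges_Cons\<close>)
qed

section \<open>Simple graphs\<close>

lemma simple_graph_edgeE:
  assumes "simple_graph V E" "e \<in> E"
  obtains u v where "e = {u, v}" "u \<noteq> v" "u \<in> V" "v \<in> V"
  using assms unfolding simple_graph_def by blast

lemma simple_graph_incident_edgeE:
  assumes "simple_graph V E" "e \<in> E" "x \<in> e"
  obtains y where "e = {x, y}" "x \<noteq> y" "y \<in> V"
  using simple_graph_edgeE[OF assms(1,2)] assms(3) by (metis insertE insert_commute singletonD)

lemma simple_graph_card_edge: "simple_graph V E \<Longrightarrow> e \<in> E \<Longrightarrow> card e = 2"
  by (erule simple_graph_edgeE) auto

lemma simple_graph_edge_subset: "simple_graph V E \<Longrightarrow> e \<in> E \<Longrightarrow> e \<subseteq> V"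
  by (erule simple_graph_edgeE) auto

lemma simple_graph_finite:
  assumes "simple_graph V E"
  shows "finite V" "finite E"
proof -
  show "finite V" using assms by (simp add: simple_graph_def)
  moreover have "E \<subseteq> Pow V" using simple_graph_edge_subset[OF assms] by blast
  ultimately show "finite E" by (simp add: finite_subset)
qed

lemma simple_graph_mono:
  assumes "simple_graph V E" "V' \<subseteq> V" "E' \<subseteq> E" "\<Union>E' \<subseteq> V'"
  shows "simple_graph V' E'"
  unfolding simple_graph_def
proof (intro conjI ballI)
  show "finite V'" using simple_graph_finite(1)[OF assms(1)] assms(2) finite_subset by blast
  fix e assume e: "e \<in> E'"
  then obtain u v where "e = {u, v}" "u \<noteq> v"
    using simple_graph_edgeE[OF assms(1)] assms(3) by (metis subsetD)
  then show "\<exists>u v. e = {u, v} \<and> u \<noteq> v \<and> u \<in> V' \<and> v \<in> V'" using e assms(4) by auto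
qed

lemma is_cycle_mono:
  "is_cycle V' E' k C \<Longrightarrow> V' \<subseteq> V \<Longrightarrow> E' \<subseteq> E \<Longrightarrow> is_cycle V E k C"
  by (auto simp: is_cycle_iff_circuit)

lemma planar_graph_mono:
  fixes V :: "'a set"
  assumes "planar_graph V E" "V' \<subseteq> V" "E' \<subseteq> E" "\<Union>E' \<subseteq> V'"
  shows "planar_graph V' E'"
proof -
  obtain p :: "'a \<Rightarrow> complex" and \<gamma> where inj: "inj_on p V"
    and edge: "\<forall>e\<in>E. arc (\<gamma> e) \<and> {pathstart (\<gamma> e), pathfinish (\<gamma> e)} = p ` e \<and>
      path_image (\<gamma> e) \<inter> p ` V = p ` e"
    and cross: "\<forall>e1\<in>E. \<forall>e2\<in>E. e1 \<noteq> e2 \<longrightarrow>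
      path_image (\<gamma> e1) \<inter> path_image (\<gamma> e2) \<subseteq> p ` (e1 \<inter> e2)"
    using assms(1) unfolding planar_graph_def by (elim exE conjE)
  have "path_image (\<gamma> e) \<inter> p ` V' = p ` e" if "e \<in> E'" for e
  proof -
    have "path_image (\<gamma> e) \<inter> p ` V' = (path_image (\<gamma> e) \<inter> p ` V) \<inter> p ` V'"
      using assms(2) by blast
    also have "path_image (\<gamma> e) \<inter> p ` V = p ` e" using edge that assms(3) by (meson subsetD)
    also have "p ` e \<inter> p ` V' = p ` e" using that assms(4) by blast
    finally show ?thesis .
  qed
  moreover have "inj_on p V'" using inj assms(2) by (rule inj_on_subset)
  ultimately show ?thesis
    unfolding planar_graph_def using edge cross assms(3)
    by (intro exI[of _ p] exI[of _ \<gamma>]) (simp add: subset_iff)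
qed

definition vertex_degree :: "'a set set \<Rightarrow> 'a \<Rightarrow> nat" where
  "vertex_degree E v = card {e \<in> E. v \<in> e}"

definition spanned :: "'a set set \<Rightarrow> 'a set \<Rightarrow> 'a set set" where
  "spanned E X = {e \<in> E. e \<subseteq> X}"

lemma finite_spanned [simp]: "finite E \<Longrightarrow> finite (spanned E X)"
  by (simp add: spanned_def)

lemma spanned_spanned: "Y \<subseteq> X \<Longrightarrow> spanned (spanned E X) Y = spanned E Y"
  by (auto simp: spanned_def)

lemma simple_graph_spanned: "simple_graph V E \<Longrightarrow> X \<subseteq> V \<Longrightarrow> simple_graph X (spanned E X)"
  by (erule simple_graph_mono) (auto simp: spanned_def)

lemma spanned_supermodular:
  assumes "finite E"
  shows "card (spanned E X) + card (spanned E Y)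
    \<le> card (spanned E (X \<union> Y)) + card (spanned E (X \<inter> Y))"
proof -
  have "card (spanned E X) + card (spanned E Y)
      = card (spanned E X \<union> spanned E Y) + card (spanned E X \<inter> spanned E Y)"
    using assms by (intro card_Un_Int) simp_all
  also have "spanned E X \<inter> spanned E Y = spanned E (X \<inter> Y)" by (auto simp: spanned_def)
  also have "card (spanned E X \<union> spanned E Y) \<le> card (spanned E (X \<union> Y))"
    using assms by (intro card_mono) (auto simp: spanned_def)
  finally show ?thesis by simp
qed

section \<open>Biconnected graphs\<close>

definition biconnected :: "'a set \<Rightarrow> 'a set set \<Rightarrow> bool" where
  "biconnected V E \<longleftrightarrow> (\<forall>V1 V2. V1 \<union> V2 = V \<and> V1 \<noteq> V \<and> V2 \<noteq> V \<and> card (V1 \<inter> V2) \<le> 1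
     \<longrightarrow> (\<exists>e\<in>E. \<not> e \<subseteq> V1 \<and> \<not> e \<subseteq> V2))"

lemma biconnected_leaving_edge:
  assumes "biconnected V E" "simple_graph V E" "R \<subseteq> V" "R \<noteq> {}" "u \<notin> R" "\<not> V \<subseteq> insert u R"
  obtains v y where "{v, y} \<in> E" "v \<in> R" "y \<in> V" "y \<notin> R" "y \<noteq> u"
proof -
  let ?V1 = "V \<inter> insert u R" and ?V2 = "V - R"
  have "card (?V1 \<inter> ?V2) \<le> card {u}" by (intro card_mono) auto
  then have "?V1 \<union> ?V2 = V \<and> ?V1 \<noteq> V \<and> ?V2 \<noteq> V \<and> card (?V1 \<inter> ?V2) \<le> 1" using assms(3-6) by auto
  then obtain e where e: "e \<in> E" "\<not> e \<subseteq> ?V1" "\<not> e \<subseteq> ?V2"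
    using assms(1) unfolding biconnected_def by meson
  obtain s t where ends: "e = {s, t}" "s \<in> V" "t \<in> V" using simple_graph_edgeE[OF assms(2) e(1)] .
  then have "s \<in> R \<and> t \<notin> R \<and> t \<noteq> u \<or> t \<in> R \<and> s \<notin> R \<and> s \<noteq> u" using e(2,3) by auto
  then show thesis using that[of s t] that[of t s] ends e(1) by (auto simp: insert_commute)
qed

lemma biconnected_ear:
  assumes "biconnected V E" "simple_graph V E"
    and S: "S \<subseteq> V" "u \<in> S" "s \<in> S" "s \<noteq> u" and uw: "{u, w} \<in> E" "w \<notin> S"
  obtains y ws where "y \<in> S" "distinct (u # ws @ [y])" "ws \<noteq> []" "set ws \<inter> S = {}"
    "path_via u ws y \<subseteq> E" "{u, w} \<in> path_via u ws y"
proof -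
  define path_to where "path_to ws v \<longleftrightarrow> distinct (u # ws @ [v]) \<and> hd (ws @ [v]) = w \<and>
    set ws \<inter> S = {} \<and> path_via u ws v \<subseteq> E" for ws v
  define R where "R = {v \<in> V - S. \<exists>ws. path_to ws v}"
  have "w \<in> V" using simple_graph_edge_subset[OF assms(2) uw(1)] by simp
  then have "w \<in> R" using uw S(2) by (auto simp: R_def path_to_def intro: exI[of _ "[]"])
  have "R \<subseteq> V" "R \<noteq> {}" "u \<notin> R" "\<not> V \<subseteq> insert u R" using \<open>w \<in> R\<close> S by (auto simp: R_def)
  then obtain v y where vy: "{v, y} \<in> E" "v \<in> R" "y \<in> V" "y \<notin> R" "y \<noteq> u"
    using biconnected_leaving_edge[OF assms(1,2)] by metis
  then obtain ws where ws: "path_to ws v" "v \<notin> S" unfolding R_def by blast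
  have "y \<notin> set ws"
  proof
    assume "y \<in> set ws"
    then obtain l r where lr: "ws = l @ y # r" by (auto dest: split_list)
    then have "path_to l y" using ws(1) by (cases l) (auto simp: path_to_def path_via_append)
    moreover have "y \<notin> S" using ws(1) lr by (auto simp: path_to_def)
    ultimately show False using vy(3,4) by (auto simp: R_def)
  qed
  then have path: "path_to (ws @ [v]) y"
    using ws vy by (auto simp: path_to_def path_via_append hd_append)
  then have "y \<in> S" using vy(3,4) by (auto simp: R_def)
  moreover have "{u, w} \<in> path_via u (ws @ [v]) y"
    using path by (cases ws) (auto simp: path_to_def)
  ultimately show thesis using that[of y "ws @ [v]"] path by (auto simp: path_to_def)
qed

lemma biconnected_circuit_exists:
  assumes "biconnected V E" "simple_graph V E" and "2 \<le> vertex_degree E u"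
  obtains C where "circuit C" "C \<subseteq> E"
proof -
  obtain e1 e2 where e: "e1 \<in> E" "u \<in> e1" "e2 \<in> E" "u \<in> e2" "e1 \<noteq> e2"
    using assms(3) card_le_Suc0_iff_eq[of "{e \<in> E. u \<in> e}"] simple_graph_finite(2)[OF assms(2)]
    unfolding vertex_degree_def by fastforce
  obtain v where v: "e1 = {u, v}" "u \<noteq> v" "v \<in> V"
    using simple_graph_incident_edgeE[OF assms(2) e(1,2)] .
  obtain w where w: "e2 = {u, w}" "u \<noteq> w" using simple_graph_incident_edgeE[OF assms(2) e(3,4)] .
  have "u \<in> V" using simple_graph_edge_subset[OF assms(2) e(1)] e(2) by blast
  then have ends: "{u, v} \<subseteq> V" "u \<in> {u, v}" "v \<in> {u, v}" "v \<noteq> u" using v by auto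
  obtain y ws where ear: "y \<in> {u, v}" "distinct (u # ws @ [y])" "ws \<noteq> []"
      "set ws \<inter> {u, v} = {}" "path_via u ws y \<subseteq> E"
    by (rule biconnected_ear[OF assms(1,2) ends, of w]) (use e v w in auto)
  have yv: "y = v" using ear(1,2) by auto
  have "circuit (path_via u ws v \<union> path_via u [] v)"
    by (rule circuit_Un_path_via) (use ear yv path_via_disjoint[of u v ws "[]"] in auto)
  moreover have "path_via u ws v \<union> path_via u [] v \<subseteq> E" using ear(5) yv e(1) v(1) by simp
  ultimately show thesis by (rule that)
qed

lemma edge_bound_delete_vertex:
  assumes simple: "simple_graph V E" and v: "v \<in> V" "vertex_degree E v \<le> k"
    and rest: "V \<noteq> {v} \<Longrightarrow> card (spanned E (V - {v})) + k \<le> k * card (V - {v})"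
  shows "card E + k \<le> k * card V"
proof (cases "V = {v}")
  case True
  then have "E = {}" using simple_graph_edgeE[OF simple] by (metis equals0I singletonD)
  then show ?thesis using True by simp
next
  case False
  have "E = {e \<in> E. v \<in> e} \<union> spanned E (V - {v})"
    using simple_graph_edge_subset[OF simple] by (auto simp: spanned_def)
  then have "card E \<le> vertex_degree E v + card (spanned E (V - {v}))"
    unfolding vertex_degree_def by (metis card_Un_le)
  moreover have "card V = Suc (card (V - {v}))"
    using card.remove[OF simple_graph_finite(1)[OF simple] v(1)] .
  ultimately show ?thesis using rest[OF False] v(2) by simp
qed

lemma edge_bound_separation:
  assumes "finite V1" "finite V2" "card (V1 \<inter> V2) \<le> 1" "\<forall>e\<in>E. e \<subseteq> V1 \<or> e \<subseteq> V2"
    and "card (spanned E V1) + k \<le> k * card V1" "card (spanned E V2) + k \<le> k * card V2"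
  shows "card E + k \<le> k * card (V1 \<union> V2)"
proof -
  have "E = spanned E V1 \<union> spanned E V2" using assms(4) by (auto simp: spanned_def)
  then have "card E \<le> card (spanned E V1) + card (spanned E V2)" by (metis card_Un_le)
  then have "card E + 2 * k \<le> k * (card V1 + card V2)" using assms(5,6) by (simp add: distrib_left)
  also have "card V1 + card V2 = card (V1 \<union> V2) + card (V1 \<inter> V2)"
    using assms(1,2) by (rule card_Un_Int)
  also have "k * \<dots> \<le> k * (card (V1 \<union> V2) + 1)" using assms(3) by (intro mult_left_mono) auto
  finally show ?thesis by simp
qed

lemma edge_bound_from_blocks:
  assumes "simple_graph V E" "V \<noteq> {}"
    and "\<And>W. W \<subseteq> V \<Longrightarrow> W \<noteq> {} \<Longrightarrow> biconnected W (spanned E W) \<Longrightarrow>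
      (\<And>v. v \<in> W \<Longrightarrow> k < vertex_degree (spanned E W) v) \<Longrightarrow> card (spanned E W) + k \<le> k * card W"
  shows "card E + k \<le> k * card V"
proof -
  have "card (spanned E W) + k \<le> k * card W" if "W \<subseteq> V" "W \<noteq> {}" for W
    using finite_subset[OF that(1) simple_graph_finite(1)[OF assms(1)]] that
  proof (induction W rule: finite_psubset_induct)
    case (psubset W)
    have IH: "card (spanned (spanned E W) X) + k \<le> k * card X" if "X \<subset> W" "X \<noteq> {}" for X
      using psubset.IH[of X] psubset.prems that by (simp add: spanned_spanned)
    consider (low_degree) v where "v \<in> W" "vertex_degree (spanned E W) v \<le> k"
      | (separable) "\<not> biconnected W (spanned E W)"
      | (block) "biconnected W (spanned E W)" "\<And>v. v \<in> W \<Longrightarrow> k < vertex_degree (spanned E W) v"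
      using leI by blast
    then show ?case
    proof cases
      case v: (low_degree v)
      then have "card (spanned (spanned E W) (W - {v})) + k \<le> k * card (W - {v})" if "W \<noteq> {v}"
        using that by (intro IH) auto
      then show ?thesis
        using edge_bound_delete_vertex[OF simple_graph_spanned[OF assms(1) psubset.prems(1)] v]
        by blast
    next
      case separable
      then obtain W1 W2 where W12: "W1 \<union> W2 = W" "W1 \<noteq> W" "W2 \<noteq> W" "card (W1 \<inter> W2) \<le> 1"
        and sep: "\<forall>e\<in>spanned E W. e \<subseteq> W1 \<or> e \<subseteq> W2" unfolding biconnected_def by blast
      have "W1 \<subset> W" "W1 \<noteq> {}" "W2 \<subset> W" "W2 \<noteq> {}" using W12(1-3) by auto
      moreover have "finite W1" "finite W2" using W12(1) psubset.hyps by auto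
      ultimately show ?thesis
        using edge_bound_separation[OF _ _ W12(4) sep] IH W12(1) by metis
    next
      case block
      then show ?thesis using assms(3) psubset.prems by blast
    qed
  qed
  moreover have "spanned E V = E"
    using simple_graph_edge_subset[OF assms(1)] by (auto simp: spanned_def)
  ultimately show ?thesis using assms(2) by fastforce
qed

section \<open>Arcs and inversions\<close>

lemma interior_path_image_arc:
  fixes g :: "real \<Rightarrow> 'a::euclidean_space"
  assumes "arc g" "2 \<le> DIM('a)"
  shows "interior (path_image g) = {}"
proof (rule ccontr)
  assume nonempty: "interior (path_image g) \<noteq> {}"
  have "continuous_on {0..1} g" "inj_on g {0..1}" using assms(1) by (auto simp: arc_def path_def)
  then obtain h where "homeomorphism {0..1} (path_image g) g h"
    using homeomorphism_compact[of "{0..1}" g] by (auto simp: path_image_def)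
  then have "continuous_on (path_image g) h" "inj_on h (path_image g)"
    unfolding homeomorphism_def by (auto intro: inj_on_inverseI)
  then have "continuous_on (interior (path_image g)) h" "inj_on h (interior (path_image g))"
    using interior_subset by (blast intro: continuous_on_subset inj_on_subset)+
  then have "DIM('a) \<le> DIM(real)"
    using nonempty by (intro invariance_of_dimension[of "interior (path_image g)" h]) auto
  then show False using assms(2) by simp
qed

lemma connected_arc_minus_pathfinish:
  assumes "arc g"
  shows "connected (path_image g - {pathfinish g})"
proof -
  have "path_image g - {pathfinish g} = g ` ({0..1} - {1})"
    unfolding path_image_def pathfinish_def using assms
    by (subst inj_on_image_set_diff[of g "{0..1}"]) (auto simp: arc_def)
  moreover have "{0..1} - {1} = {0..<1::real}" by auto
  moreover have "continuous_on {0..<1} g"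
    using arc_imp_path[OF assms] by (auto simp: path_def elim: continuous_on_subset)
  ultimately show ?thesis by (simp add: connected_continuous_image)
qed

lemma connected_subset_inside:
  assumes "connected S" "S \<inter> K = {}" "S \<inter> inside K \<noteq> {}"
  shows "S \<subseteq> inside K"
proof
  fix y assume "y \<in> S"
  obtain x where "x \<in> S" "x \<in> inside K" using assms(3) by blast
  moreover have "connected_component (- K) x y"
    using assms(1,2) \<open>x \<in> S\<close> \<open>y \<in> S\<close> unfolding connected_component_def by blast
  ultimately show "y \<in> inside K" using inside_same_component by blast
qed

text \<open>As \<open>inverse 0 = 0\<close>, an inversion is injective on the whole plane.\<close>

definition inversion :: "complex \<Rightarrow> complex \<Rightarrow> complex" where
  "inversion a z = inverse (z - a)"

lemma inj_on_inversion: "inj_on (inversion a) S"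
  by (auto simp: inversion_def inj_on_def)

lemma continuous_on_inversion: "a \<notin> S \<Longrightarrow> continuous_on S (inversion a)"
  unfolding inversion_def by (intro continuous_intros) auto

lemma inversion_inverse: "inversion a (a + inverse w) = w"
  by (simp add: inversion_def)

lemma inversion_image_unbounded:
  assumes "open U" "a \<in> U"
  shows "\<not> bounded (inversion a ` (U - {a}))"
proof
  assume "bounded (inversion a ` (U - {a}))"
  then obtain B where B: "\<And>z. z \<in> U - {a} \<Longrightarrow> norm (inversion a z) \<le> B"
    unfolding bounded_iff by blast
  have "filterlim (inversion a) at_infinity (at a)"
    unfolding inversion_def
    by (rule filterlim_compose[OF filterlim_inverse_at_infinity])
      (auto simp: filterlim_at intro!: tendsto_eq_intros eventually_at_filter[THEN iffD2])
  then have "\<forall>\<^sub>F z in at a. \<bar>B\<bar> + 1 \<le> norm (inversion a z)"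
    using filterlim_at_infinity[of 0 "inversion a" "at a"] by simp
  moreover have "\<forall>\<^sub>F z in at a. z \<in> U - {a}"
    using assms by (auto simp: eventually_at_topological)
  ultimately have "\<forall>\<^sub>F z in at a. False"
    by eventually_elim (use B in force)
  then show False by simp
qed

lemma connected_inversion_image: "connected S \<Longrightarrow> a \<notin> S \<Longrightarrow> connected (inversion a ` S)"
  using connected_continuous_image[OF continuous_on_inversion] .

lemma inversion_image_Int: "inversion a ` S \<inter> inversion a ` T = inversion a ` (S \<inter> T)"
  using inj_on_image_Int[OF inj_on_inversion[of a UNIV]] by blast

lemma inversion_punctured_Int_inside:
  assumes U: "open U" "connected U" "a \<in> U" "U \<inter> K = {}"
    and bounded: "bounded (inside (inversion a ` K))"
  shows "inversion a ` (U - {a}) \<inter> inside (inversion a ` K) = {}"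
proof (rule ccontr)
  assume meets: "\<not> ?thesis"
  have "connected (U - {a})" using U(1,2) by (intro connected_open_delete) auto
  then have "connected (inversion a ` (U - {a}))" by (simp add: connected_inversion_image)
  moreover have "inversion a ` (U - {a}) \<inter> inversion a ` K = {}"
    using U(4) by (auto simp: inversion_image_Int)
  ultimately have "inversion a ` (U - {a}) \<subseteq> inside (inversion a ` K)"
    using meets by (rule connected_subset_inside)
  then have "bounded (inversion a ` (U - {a}))" using bounded bounded_subset by blast
  then show False using inversion_image_unbounded[OF U(1,3)] by blast
qed

text \<open>Since the inside of the image of \<open>K\<close> avoids the image of the punctured inside of \<open>K\<close>, its
  points come from the outside of \<open>K\<close>.\<close>

lemma inversion_swaps_sides:
  assumes c: "simple_path c" "pathfinish c = pathstart c" "path_image c = K"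
    and c': "simple_path c'" "pathfinish c' = pathstart c'" "path_image c' = inversion a ` K"
    and a: "a \<in> inside K" and z: "z \<noteq> a" "z \<notin> K"
  shows "inversion a z \<in> inside (inversion a ` K) \<longleftrightarrow> z \<notin> inside K"
proof -
  let ?K' = "inversion a ` K" and ?I = "inside K - {a}"
  note jordan = Jordan_inside_outside[OF c(1,2), unfolded c(3)]
  note jordan' = Jordan_inside_outside[OF c'(1,2), unfolded c'(3)]
  have sides: "inside K \<union> outside K = - K" "inside K \<inter> outside K = {}" using jordan by metis+
  have inside_image: "inversion a ` ?I \<inter> inside ?K' = {}"
    using jordan jordan' a sides(1) by (intro inversion_punctured_Int_inside) auto
  have "a \<notin> outside K" using sides(2) a by blast
  have "inversion a ` outside K \<subseteq> inside ?K'"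
  proof (rule connected_subset_inside)
    show "connected (inversion a ` outside K)"
      using jordan \<open>a \<notin> outside K\<close> by (simp add: connected_inversion_image)
    show "inversion a ` outside K \<inter> ?K' = {}" using sides(1) by (auto simp: inversion_image_Int)
    have "\<not> inside ?K' \<subseteq> {0}"
      using jordan' by (metis finite.emptyI finite_insert finite_imp_not_open finite_subset)
    then obtain w where w: "w \<in> inside ?K'" "w \<noteq> 0" by blast
    define y where "y = a + inverse w"
    have y: "inversion a y = w" "y \<noteq> a" using w(2) by (simp_all add: y_def inversion_inverse)
    have inside: "inversion a y \<in> inside ?K'" using w(1) y(1) by simp
    then have "y \<notin> K" using inside_no_overlap[of ?K'] by blast
    moreover have "y \<notin> inside K" using inside inside_image y(2) by blast
    ultimately have "inversion a y \<in> inversion a ` outside K" using sides(1) by blast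
    then show "inversion a ` outside K \<inter> inside ?K' \<noteq> {}" using inside by blast
  qed
  moreover have "z \<in> ?I \<or> z \<in> outside K" "z \<in> outside K \<longleftrightarrow> z \<notin> inside K" using sides z by blast+
  ultimately show ?thesis using inside_image by blast
qed

section \<open>Plane drawings\<close>

locale drawing =
  fixes V :: "'a set" and E :: "'a set set"
    and p :: "'a \<Rightarrow> complex" and \<gamma> :: "'a set \<Rightarrow> real \<Rightarrow> complex"
  assumes simple: "simple_graph V E"
    and inj_vertices: "inj_on p V"
    and arc_edge: "e \<in> E \<Longrightarrow> arc (\<gamma> e)"
    and edge_ends: "e \<in> E \<Longrightarrow> {pathstart (\<gamma> e), pathfinish (\<gamma> e)} = p ` e"
    and vertices_on_edge: "e \<in> E \<Longrightarrow> path_image (\<gamma> e) \<inter> p ` V = p ` e"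
    and edges_cross: "e1 \<in> E \<Longrightarrow> e2 \<in> E \<Longrightarrow> e1 \<noteq> e2 \<Longrightarrow>
      path_image (\<gamma> e1) \<inter> path_image (\<gamma> e2) \<subseteq> p ` (e1 \<inter> e2)"

lemma planar_graph_drawing:
  fixes V :: "'a set"
  assumes "simple_graph V E" "planar_graph V E"
  obtains p \<gamma> where "drawing V E p \<gamma>"
proof -
  obtain p :: "'a \<Rightarrow> complex" and \<gamma> where "inj_on p V"
    "\<forall>e\<in>E. arc (\<gamma> e) \<and> {pathstart (\<gamma> e), pathfinish (\<gamma> e)} = p ` e \<and>
      path_image (\<gamma> e) \<inter> p ` V = p ` e"
    "\<forall>e1\<in>E. \<forall>e2\<in>E. e1 \<noteq> e2 \<longrightarrow> path_image (\<gamma> e1) \<inter> path_image (\<gamma> e2) \<subseteq> p ` (e1 \<inter> e2)"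
    using assms(2) unfolding planar_graph_def by (elim exE conjE)
  then have "drawing V E p \<gamma>" using assms(1) by unfold_locales simp_all
  then show thesis by (rule that)
qed

context drawing
begin

definition curve :: "'a set set \<Rightarrow> complex set" where
  "curve D = (\<Union>e\<in>D. path_image (\<gamma> e))"

definition mid :: "'a set \<Rightarrow> complex" where
  "mid e = \<gamma> e (1/2)"

text \<open>An edge lies inside a cycle not containing it iff its midpoint does; as midpoints lie on no
  other edge, the combinatorial form of the theta-curve theorem needs no connectedness argument.\<close>

definition inner_edges :: "'a set set \<Rightarrow> 'a set set" where
  "inner_edges C = {e \<in> E. mid e \<in> inside (curve C)}"

definition inner_vertices :: "'a set set \<Rightarrow> 'a set" where
  "inner_vertices C = {v \<in> V. p v \<in> inside (curve C)}"

lemma curve_Un: "curve (A \<union> B) = curve A \<union> curve B"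
  by (auto simp: curve_def)

lemma curve_insert: "curve (insert e D) = path_image (\<gamma> e) \<union> curve D"
  by (simp add: curve_def)

lemma path_image_subset_curve: "e \<in> D \<Longrightarrow> path_image (\<gamma> e) \<subseteq> curve D"
  by (auto simp: curve_def)

lemma curve_empty: "curve {} = {}"
  by (simp add: curve_def)

lemma Union_edges_subset: "D \<subseteq> E \<Longrightarrow> \<Union>D \<subseteq> V"
  using simple_graph_edge_subset[OF simple] by blast

lemma finite_inner: "finite (inner_edges C)" "finite (inner_vertices C)"
  using simple_graph_finite[OF simple] by (simp_all add: inner_edges_def inner_vertices_def)

lemma vertex_in_curve_iff:
  assumes "D \<subseteq> E" "v \<in> V"
  shows "p v \<in> curve D \<longleftrightarrow> v \<in> \<Union>D"
proof -
  have "p v \<in> path_image (\<gamma> e) \<longleftrightarrow> v \<in> e" if "e \<in> E" for e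
  proof -
    have "p v \<in> path_image (\<gamma> e) \<longleftrightarrow> p v \<in> p ` e" using vertices_on_edge[OF that] assms(2) by blast
    also have "\<dots> \<longleftrightarrow> v \<in> e"
      using inj_vertices assms(2) simple_graph_edge_subset[OF simple that]
      by (rule inj_on_image_mem_iff)
    finally show ?thesis .
  qed
  then show ?thesis using assms(1) unfolding curve_def by blast
qed

lemma mid_in_path_image: "mid e \<in> path_image (\<gamma> e)"
  by (auto simp: mid_def path_image_def)

lemma mid_not_vertex:
  assumes "e \<in> E" "v \<in> V"
  shows "mid e \<noteq> p v"
proof
  assume "mid e = p v"
  then have "mid e \<in> p ` e"
    using vertices_on_edge[OF assms(1)] mid_in_path_image[of e] assms(2) by auto
  then have "\<gamma> e (1/2) = \<gamma> e 0 \<or> \<gamma> e (1/2) = \<gamma> e 1"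
    using edge_ends[OF assms(1)] by (auto simp: mid_def pathstart_def pathfinish_def)
  moreover have "inj_on (\<gamma> e) {0..1}" using arc_edge[OF assms(1)] by (simp add: arc_def)
  ultimately show False by (auto dest: inj_onD)
qed

lemma mid_in_curve_iff:
  assumes "D \<subseteq> E" "e \<in> E"
  shows "mid e \<in> curve D \<longleftrightarrow> e \<in> D"
proof
  assume "mid e \<in> curve D"
  then obtain d where d: "d \<in> D" "mid e \<in> path_image (\<gamma> d)" by (auto simp: curve_def)
  have "mid e \<notin> p ` (d \<inter> e)"
    using mid_not_vertex[OF assms(2)] simple_graph_edge_subset[OF simple assms(2)] by fastforce
  then have "d = e" using edges_cross[of d e] d mid_in_path_image[of e] assms by blast
  then show "e \<in> D" using d(1) by simp
qed (use mid_in_path_image in \<open>auto simp: curve_def\<close>)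

lemma curve_Int_subset:
  assumes "A \<subseteq> E" "B \<subseteq> E" "A \<inter> B = {}"
  shows "curve A \<inter> curve B \<subseteq> p ` (\<Union>A \<inter> \<Union>B)"
proof
  fix z assume "z \<in> curve A \<inter> curve B"
  then obtain d e where de: "d \<in> A" "e \<in> B" "z \<in> path_image (\<gamma> d)" "z \<in> path_image (\<gamma> e)"
    by (auto simp: curve_def)
  then have "z \<in> p ` (d \<inter> e)" using edges_cross[of d e] assms by blast
  then show "z \<in> p ` (\<Union>A \<inter> \<Union>B)" using de by blast
qed

lemma inner_edges_disjoint:
  assumes "C \<subseteq> E"
  shows "inner_edges C \<inter> C = {}"
  using mid_in_curve_iff[OF assms] inside_no_overlap[of "curve C"]
  unfolding inner_edges_def by blast

lemma inner_vertices_disjoint: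
  assumes "C \<subseteq> E"
  shows "inner_vertices C \<inter> \<Union>C = {}"
  using vertex_in_curve_iff[OF assms] inside_no_overlap[of "curve C"]
  unfolding inner_vertices_def by blast

lemma edge_arc_from:
  assumes "{x, y} \<in> E"
  obtains g where "arc g" "pathstart g = p x" "pathfinish g = p y"
    "path_image g = path_image (\<gamma> {x, y})"
proof (cases "pathstart (\<gamma> {x, y}) = p x")
  case True
  then show thesis using that[of "\<gamma> {x, y}"] arc_edge[OF assms] edge_ends[OF assms]
    by (auto simp: doubleton_eq_iff)
next
  case False
  then show thesis
    using that[of "reversepath (\<gamma> {x, y})"] arc_edge[OF assms] edge_ends[OF assms]
    by (auto simp: doubleton_eq_iff arc_reversepath)
qed

text \<open>The arc from a vertex \<open>x\<close> off \<open>C\<close> along an edge \<open>e\<close> meets \<open>C\<close> at most in its other end.\<close>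

lemma inner_vertex_iff_inner_edge:
  assumes C: "C \<subseteq> E" and e: "e \<in> E" "x \<in> e" and x: "x \<notin> \<Union>C"
  shows "x \<in> inner_vertices C \<longleftrightarrow> e \<in> inner_edges C"
proof -
  obtain y where y: "e = {x, y}" "x \<noteq> y" "y \<in> V" using simple_graph_incident_edgeE[OF simple e] .
  then obtain g where g: "arc g" "pathstart g = p x" "pathfinish g = p y"
      "path_image g = path_image (\<gamma> e)"
    using edge_arc_from e(1) by metis
  let ?S = "path_image g - {p y}"
  have "e \<notin> C" using x e(2) by blast
  then have "path_image g \<inter> curve C \<subseteq> p ` (e \<inter> \<Union>C)"
    using curve_Int_subset[of "{e}" C] C e(1) g(4) by (auto simp: curve_def)
  also have "\<dots> \<subseteq> {p y}" using y(1) x by auto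
  finally have "?S \<inter> curve C = {}" by auto
  moreover have "connected ?S" using connected_arc_minus_pathfinish[OF g(1)] g(3) by simp
  moreover have "p x \<in> ?S"
    using g arc_distinct_ends[OF g(1)] pathstart_in_path_image[of g] by auto
  moreover have "mid e \<in> ?S"
    using g(4) mid_in_path_image[of e] mid_not_vertex[OF e(1) y(3)] by simp
  ultimately have "p x \<in> inside (curve C) \<longleftrightarrow> mid e \<in> inside (curve C)"
    using connected_subset_inside by blast
  moreover have "x \<in> V" using simple_graph_edge_subset[OF simple e(1)] e(2) by blast
  ultimately show ?thesis using e(1) by (simp add: inner_vertices_def inner_edges_def)
qed

lemma path_via_arc:
  assumes "distinct (a # xs @ [b])" "path_via a xs b \<subseteq> E"
  obtains g where "arc g" "pathstart g = p a" "pathfinish g = p b"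
    "path_image g = curve (path_via a xs b)"
proof -
  have "\<exists>g. arc g \<and> pathstart g = p a \<and> pathfinish g = p b \<and> path_image g = curve (path_via a xs b)"
    using assms
  proof (induction xs arbitrary: a)
    case Nil
    then have "{a, b} \<in> E" by simp
    then obtain g where "arc g" "pathstart g = p a" "pathfinish g = p b"
        "path_image g = path_image (\<gamma> {a, b})"
      by (rule edge_arc_from)
    then show ?case by (intro exI[of _ g]) (simp add: curve_def)
  next
    case (Cons x xs)
    have ax: "{a, x} \<in> E" and rest: "path_via x xs b \<subseteq> E" using Cons.prems by auto
    obtain g where g: "arc g" "pathstart g = p a" "pathfinish g = p x"
        "path_image g = path_image (\<gamma> {a, x})"
      using edge_arc_from[OF ax] .
    obtain h where h: "arc h" "pathstart h = p x" "pathfinish h = p b"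
        "path_image h = curve (path_via x xs b)"
      using Cons.IH[of x] Cons.prems by auto
    have "a \<notin> \<Union>(path_via x xs b)" using Cons.prems by auto
    then have "{{a, x}} \<inter> path_via x xs b = {}" by blast
    then have "path_image g \<inter> path_image h \<subseteq> p ` ({a, x} \<inter> \<Union>(path_via x xs b))"
      using curve_Int_subset[of "{{a, x}}", OF _ rest] ax g(4) h(4) by (simp add: curve_def)
    also have "\<dots> \<subseteq> {p x}" using \<open>a \<notin> \<Union>(path_via x xs b)\<close> by auto
    finally have "arc (g +++ h)" using g h by (intro arc_join) auto
    then show ?case
      using g h by (intro exI[of _ "g +++ h"]) (simp add: path_image_join curve_insert)
  qed
  then show thesis using that by blast
qed

lemma curve_path_via_Int:
  assumes "distinct (a # b # xs @ ys)" "path_via a xs b \<inter> path_via a ys b = {}"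
    and "path_via a xs b \<subseteq> E" "path_via a ys b \<subseteq> E"
  shows "curve (path_via a xs b) \<inter> curve (path_via a ys b) = {p a, p b}"
proof
  show "curve (path_via a xs b) \<inter> curve (path_via a ys b) \<subseteq> {p a, p b}"
    using curve_Int_subset[OF assms(3,4,2)] assms(1) by auto
  show "{p a, p b} \<subseteq> curve (path_via a xs b) \<inter> curve (path_via a ys b)"
    using Union_edges_subset[OF assms(3)] by (simp add: vertex_in_curve_iff assms(3,4))
qed

lemma circuit_simple_path:
  assumes "circuit C" "C \<subseteq> E"
  obtains c where "simple_path c" "pathfinish c = pathstart c" "path_image c = curve C"
proof -
  obtain a b xs ys where C: "distinct (a # b # xs @ ys)" "path_via a xs b \<inter> path_via a ys b = {}"
      "C = path_via a xs b \<union> path_via a ys b"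
    using circuit_two_paths[OF assms(1)] .
  have sub: "path_via a xs b \<subseteq> E" "path_via a ys b \<subseteq> E" using C(3) assms(2) by auto
  obtain g where g: "arc g" "pathstart g = p a" "pathfinish g = p b"
      "path_image g = curve (path_via a xs b)"
    using path_via_arc[OF _ sub(1)] C(1) by auto
  obtain h where h: "arc h" "pathstart h = p a" "pathfinish h = p b"
      "path_image h = curve (path_via a ys b)"
    using path_via_arc[OF _ sub(2)] C(1) by auto
  have "path_image g \<inter> path_image h = {p a, p b}"
    using curve_path_via_Int[OF C(1,2) sub] g(4) h(4) by simp
  then have "simple_path (g +++ reversepath h)"
    using g h by (intro simple_path_join_loop) (auto simp: arc_reversepath)
  moreover have "path_image (g +++ reversepath h) = curve C"
    using g h C(3) by (simp add: path_image_join curve_Un)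
  ultimately show thesis using that g h by simp
qed

lemma curve_closed_empty_interior:
  assumes "D \<subseteq> E"
  shows "closed (curve D)" "interior (curve D) = {}"
proof -
  have "finite D" using assms simple_graph_finite(2)[OF simple] finite_subset by blast
  then have "closed (curve D) \<and> interior (curve D) = {}"
    using assms
  proof (induction D)
    case (insert e D)
    then have "arc (\<gamma> e)" using arc_edge by simp
    then show ?case
      using insert
      by (simp add: curve_insert closed_Un closed_arc_image interior_path_image_arc
          interior_closed_Un_empty_interior)
  qed (simp add: curve_empty)
  then show "closed (curve D)" "interior (curve D) = {}" by simp_all
qed

lemma drawing_compose:
  assumes f: "continuous_on S f" "inj_on f S" and S: "curve E \<subseteq> S" "p ` V \<subseteq> S"
  shows "drawing V E (f \<circ> p) (\<lambda>e. f \<circ> \<gamma> e)"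
proof
  note edge = order_trans[OF path_image_subset_curve S(1)]
  show "simple_graph V E" by (rule simple)
  show "inj_on (f \<circ> p) V" using inj_vertices f(2) S(2) by (blast intro: comp_inj_on inj_on_subset)
  fix e assume e: "e \<in> E"
  show "arc (f \<circ> \<gamma> e)"
    unfolding arc_def
  proof
    show "path (f \<circ> \<gamma> e)"
      using arc_imp_path[OF arc_edge[OF e]] continuous_on_subset[OF f(1) edge[OF e]]
      by (rule path_continuous_image)
    show "inj_on (f \<circ> \<gamma> e) {0..1}"
      using arc_edge[OF e] inj_on_subset[OF f(2) edge[OF e]]
      by (intro comp_inj_on) (auto simp: arc_def path_image_def)
  qed
  show "{pathstart (f \<circ> \<gamma> e), pathfinish (f \<circ> \<gamma> e)} = (f \<circ> p) ` e"
    using arg_cong[OF edge_ends[OF e], of "image f"]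
    by (simp add: pathstart_compose pathfinish_compose image_image)
  show "path_image (f \<circ> \<gamma> e) \<inter> (f \<circ> p) ` V = (f \<circ> p) ` e"
    using inj_on_image_Int[OF f(2) edge[OF e] S(2)] vertices_on_edge[OF e]
    by (simp add: path_image_compose image_comp)
  fix d assume d: "d \<in> E" "e \<noteq> d"
  have "path_image (f \<circ> \<gamma> e) \<inter> path_image (f \<circ> \<gamma> d) = f ` (path_image (\<gamma> e) \<inter> path_image (\<gamma> d))"
    using inj_on_image_Int[OF f(2) edge[OF e] edge[OF d(1)]] by (simp add: path_image_compose)
  also have "\<dots> \<subseteq> f ` p ` (e \<inter> d)" using edges_cross[OF e d] by (rule image_mono)
  finally show "path_image (f \<circ> \<gamma> e) \<inter> path_image (f \<circ> \<gamma> d) \<subseteq> (f \<circ> p) ` (e \<inter> d)"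
    by (simp add: image_comp)
qed

lemma inside_not_covered:
  assumes "circuit C" "C \<subseteq> E"
  obtains a where "a \<in> inside (curve C)" "a \<notin> curve E" "a \<notin> p ` V"
proof -
  obtain c where c: "simple_path c" "pathfinish c = pathstart c" "path_image c = curve C"
    using circuit_simple_path[OF assms] .
  have "finite (p ` V)" using simple_graph_finite(1)[OF simple] by simp
  then have "interior (curve E \<union> p ` V) = {}"
    using curve_closed_empty_interior[of E]
    by (simp add: interior_closed_Un_empty_interior empty_interior_finite)
  moreover have "open (inside (curve C))" "inside (curve C) \<noteq> {}"
    using Jordan_inside_outside[OF c(1,2), unfolded c(3)] by simp_all
  ultimately have "\<not> inside (curve C) \<subseteq> curve E \<union> p ` V"
    using interior_maximal by (metis subset_empty)
  then show thesis using that by blast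
qed

theorem inverted_drawing_exists:
  assumes C: "circuit C" "C \<subseteq> E"
  obtains q \<delta> where "drawing V E q \<delta>"
    "drawing.inner_edges E \<delta> C = E - C - inner_edges C"
    "drawing.inner_vertices V q \<delta> C = V - \<Union>C - inner_vertices C"
proof -
  obtain c where c: "simple_path c" "pathfinish c = pathstart c" "path_image c = curve C"
    using circuit_simple_path[OF C] .
  obtain a where a: "a \<in> inside (curve C)" "a \<notin> curve E" "a \<notin> p ` V"
    using inside_not_covered[OF C] .
  define q where "q = inversion a \<circ> p"
  define \<delta> where "\<delta> e = inversion a \<circ> \<gamma> e" for e
  interpret inv: drawing V E q \<delta>
    unfolding q_def \<delta>_def
    using a by (intro drawing_compose[of "- {a}"] continuous_on_inversion inj_on_inversion) auto
  have curve: "inv.curve C = inversion a ` curve C"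
    by (auto simp: inv.curve_def curve_def \<delta>_def path_image_compose)
  obtain c' where c': "simple_path c'" "pathfinish c' = pathstart c'"
      "path_image c' = inversion a ` curve C"
    using inv.circuit_simple_path[OF C] curve by metis
  have side: "inversion a z \<in> inside (inv.curve C) \<longleftrightarrow> z \<notin> inside (curve C)"
    if "z \<noteq> a" "z \<notin> curve C" for z
    using inversion_swaps_sides[OF c c' a(1) that] by (simp add: curve)
  have "e \<in> inv.inner_edges C \<longleftrightarrow> e \<notin> inner_edges C" if "e \<in> E" "e \<notin> C" for e
  proof -
    have "mid e \<noteq> a" "mid e \<notin> curve C"
      using a(2) mid_in_curve_iff[of _ e] C(2) that by auto
    then show ?thesis using side that(1)
      unfolding inv.inner_edges_def inv.mid_def by (simp add: inner_edges_def mid_def \<delta>_def)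
  qed
  then have edges: "inv.inner_edges C = E - C - inner_edges C"
    using inv.inner_edges_disjoint[OF C(2)] by (auto simp: inv.inner_edges_def)
  have "v \<in> inv.inner_vertices C \<longleftrightarrow> v \<notin> inner_vertices C" if "v \<in> V" "v \<notin> \<Union>C" for v
  proof -
    have "p v \<noteq> a" "p v \<notin> curve C" using a(3) vertex_in_curve_iff[OF C(2)] that by auto
    then show ?thesis using side that(1)
      unfolding inv.inner_vertices_def by (simp add: inner_vertices_def q_def)
  qed
  then have "inv.inner_vertices C = V - \<Union>C - inner_vertices C"
    using inv.inner_vertices_disjoint[OF C(2)] by (auto simp: inv.inner_vertices_def)
  with inv.drawing_axioms edges show thesis by (rule that)
qed

lemma chord_inside_exists:
  assumes bi: "biconnected V E" and C: "circuit C" "C \<subseteq> E" and inner: "inner_edges C \<noteq> {}"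
  obtains a b zs where "a \<in> \<Union>C" "b \<in> \<Union>C" "distinct (a # zs @ [b])" "set zs \<inter> \<Union>C = {}"
    "path_via a zs b \<subseteq> E" "path_via a zs b \<inter> C = {}" "path_via a zs b \<inter> inner_edges C \<noteq> {}"
proof (cases "\<exists>e\<in>inner_edges C. e \<subseteq> \<Union>C")
  case True
  then obtain e where e: "e \<in> inner_edges C" "e \<subseteq> \<Union>C" by blast
  then have "e \<in> E" "e \<notin> C" using inner_edges_disjoint[OF C(2)] by (auto simp: inner_edges_def)
  moreover from this obtain a b where "e = {a, b}" "a \<noteq> b"
    using simple_graph_edgeE[OF simple] by metis
  ultimately show thesis using that[of a b "[]"] e by simp
next
  case False
  note disjoint = inner_vertices_disjoint[OF C(2)] and CV = Union_edges_subset[OF C(2)]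
  obtain e x where e: "e \<in> inner_edges C" "x \<in> e" "x \<notin> \<Union>C" using False inner by blast
  then have x: "x \<in> inner_vertices C"
    using inner_vertex_iff_inner_edge[OF C(2), of e x] by (auto simp: inner_edges_def)
  obtain r where r: "r \<in> \<Union>C" using circuit_other_vertex[OF C(1)] .
  obtain t where t: "t \<in> \<Union>C" "t \<noteq> r" using circuit_other_vertex[OF C(1)] .
  have "inner_vertices C \<subseteq> V" "inner_vertices C \<noteq> {}" "r \<notin> inner_vertices C"
    "\<not> V \<subseteq> insert r (inner_vertices C)"
    using x r t CV disjoint by (auto simp: inner_vertices_def)
  then obtain w u where wu: "{w, u} \<in> E" "w \<in> inner_vertices C" "u \<notin> inner_vertices C"
    using biconnected_leaving_edge[OF bi simple] by metis
  have w: "w \<notin> \<Union>C" using wu(2) disjoint by blast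
  then have wu_inner: "{w, u} \<in> inner_edges C"
    using inner_vertex_iff_inner_edge[OF C(2) wu(1), of w] wu(2) by simp
  then have u: "u \<in> \<Union>C" using inner_vertex_iff_inner_edge[OF C(2) wu(1), of u] wu(3) by auto
  obtain s where s: "s \<in> \<Union>C" "s \<noteq> u" using circuit_other_vertex[OF C(1)] .
  obtain y ws where y: "y \<in> \<Union>C" "distinct (u # ws @ [y])" "ws \<noteq> []" "set ws \<inter> \<Union>C = {}"
      "path_via u ws y \<subseteq> E" "{u, w} \<in> path_via u ws y"
    by (rule biconnected_ear[OF bi simple CV u s _ w]) (use wu(1) in \<open>simp add: insert_commute\<close>)
  have "path_via u ws y \<inter> C = {}" using y(2-4) by (rule path_via_Int_empty)
  moreover have "path_via u ws y \<inter> inner_edges C \<noteq> {}"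
    using y(6) wu_inner by (auto simp: insert_commute)
  ultimately show thesis using that u y by blast
qed

end

section \<open>Tilings by circuits\<close>

text \<open>The members of \<open>F\<close> at \<open>y\<close>, two of them being joined when they share an edge at \<open>y\<close>, form a
  connected graph. This is why a vertex \<open>y\<close> at which two faces share two edges has degree 2.\<close>

definition link_connected :: "'a set set set \<Rightarrow> 'a \<Rightarrow> bool" where
  "link_connected F y \<longleftrightarrow> (\<forall>G1 G2. G1 \<union> G2 = F \<and> y \<in> \<Union>(\<Union>G1) \<and> y \<in> \<Union>(\<Union>G2) \<longrightarrow>
     (\<exists>D1\<in>G1. \<exists>D2\<in>G2. \<exists>e\<in>D1 \<inter> D2. y \<in> e))"

lemma link_connectedD:
  assumes "link_connected F y" "G1 \<union> G2 = F" "D1 \<in> G1" "y \<in> \<Union>D1" "D2 \<in> G2" "y \<in> \<Union>D2"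
  obtains D1' D2' e where "D1' \<in> G1" "D2' \<in> G2" "e \<in> D1'" "e \<in> D2'" "y \<in> e"
proof -
  have "y \<in> \<Union>(\<Union>G1)" "y \<in> \<Union>(\<Union>G2)" using assms(3-6) by auto
  then have "\<exists>D1\<in>G1. \<exists>D2\<in>G2. \<exists>e\<in>D1 \<inter> D2. y \<in> e"
    using assms(1,2) unfolding link_connected_def by simp
  then show thesis using that by blast
qed

lemma link_connected_singleton: "link_connected {D} y"
  unfolding link_connected_def
proof (intro allI impI)
  fix G1 G2 assume "G1 \<union> G2 = {D} \<and> y \<in> \<Union>(\<Union>G1) \<and> y \<in> \<Union>(\<Union>G2)"
  moreover from this have "G1 = {D}" "G2 = {D}" by auto
  ultimately show "\<exists>D1\<in>G1. \<exists>D2\<in>G2. \<exists>e\<in>D1 \<inter> D2. y \<in> e" by auto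
qed

lemma link_connected_Un:
  assumes link: "link_connected F1 y" "link_connected F2 y"
    and shared: "y \<in> \<Union>(\<Union>F1) \<Longrightarrow> y \<in> \<Union>(\<Union>F2) \<Longrightarrow> \<exists>D1\<in>F1. \<exists>D2\<in>F2. \<exists>e\<in>D1 \<inter> D2. y \<in> e"
  shows "link_connected (F1 \<union> F2) y"
  unfolding link_connected_def
proof (intro allI impI)
  fix G1 G2 assume G: "G1 \<union> G2 = F1 \<union> F2 \<and> y \<in> \<Union>(\<Union>G1) \<and> y \<in> \<Union>(\<Union>G2)"
  let ?joined = "\<exists>D1\<in>G1. \<exists>D2\<in>G2. \<exists>e\<in>D1 \<inter> D2. y \<in> e"
  have within: ?joined
    if "H \<subseteq> F1 \<union> F2" "link_connected H y"
      "D1 \<in> G1 \<inter> H" "D2 \<in> G2 \<inter> H" "y \<in> \<Union>D1" "y \<in> \<Union>D2" for H D1 D2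
  proof -
    have "(G1 \<inter> H) \<union> (G2 \<inter> H) = H" using G that(1) by auto
    then show ?joined by (rule link_connectedD[OF that(2) _ that(3,5,4,6)]) blast
  qed
  obtain D1 D2 where D: "D1 \<in> G1" "D2 \<in> G2" "y \<in> \<Union>D1" "y \<in> \<Union>D2" using G by blast
  then consider (same) "D1 \<in> F1 \<and> D2 \<in> F1 \<or> D1 \<in> F2 \<and> D2 \<in> F2"
    | (different) "D1 \<in> F1 \<and> D2 \<in> F2 \<or> D1 \<in> F2 \<and> D2 \<in> F1" using G by blast
  then show ?joined
  proof cases
    case same
    then show ?joined using within[of F1 D1 D2] within[of F2 D1 D2] link D by blast
  next
    case different
    then obtain H1 H2 e where H: "H1 \<in> F1" "H2 \<in> F2" "e \<in> H1" "e \<in> H2" "y \<in> e"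
      using shared D by blast
    then have "y \<in> \<Union>H1" "y \<in> \<Union>H2" "H1 \<in> G1 \<union> G2" "H2 \<in> G1 \<union> G2" using G by auto
    then show ?joined
      using different H D link within[of F1 D1 H1] within[of F2 H2 D2]
        within[of F2 D1 H2] within[of F1 H1 D2]
      by blast
  qed
qed

text \<open>The circuits in \<open>F\<close> tile a disc with boundary \<open>C\<close>, inner edges \<open>I\<close> and inner vertices \<open>J\<close>. The
  case \<open>C = {}\<close> describes a tiling of the sphere.\<close>

locale tiling =
  fixes C I :: "'a set set" and J :: "'a set" and F :: "'a set set set"
  assumes finite_faces: "finite F"
    and boundary_inner_edges: "C \<inter> I = {}"
    and boundary_inner_vertices: "\<Union>C \<inter> J = {}"
    and face_circuit: "D \<in> F \<Longrightarrow> circuit D"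
    and face_edges: "D \<in> F \<Longrightarrow> D \<subseteq> C \<union> I"
    and face_vertices: "D \<in> F \<Longrightarrow> \<Union>D \<subseteq> \<Union>C \<union> J"
    and face_within_boundary: "D \<in> F \<Longrightarrow> D \<inter> I = {} \<Longrightarrow> D = C \<and> I = {}"
    and faces_at_inner_edge: "e \<in> I \<Longrightarrow> card {D \<in> F. e \<in> D} = 2"
    and faces_at_boundary_edge: "e \<in> C \<Longrightarrow> card {D \<in> F. e \<in> D} = 1"
    and link: "link_connected F y"
begin

lemma faces_at_outer_edge:
  assumes "e \<notin> C" "e \<notin> I"
  shows "card {D \<in> F. e \<in> D} = 0"
proof -
  have "{D \<in> F. e \<in> D} = {}" using face_edges assms by blast
  then show ?thesis by (simp only: card.empty)
qed

lemma face_at_boundary_edge: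
  assumes "e \<in> C"
  obtains D where "D \<in> F" "e \<in> D"
proof -
  have "{D \<in> F. e \<in> D} \<noteq> {}" using faces_at_boundary_edge[OF assms] by force
  then show thesis using that by blast
qed

end

definition disc_tiling :: "'a set set \<Rightarrow> 'a set set \<Rightarrow> 'a set \<Rightarrow> 'a set set set \<Rightarrow> bool" where
  "disc_tiling C I J F \<longleftrightarrow> tiling C I J F \<and> card F + card J = card I + 1"

definition sphere_tiling :: "'a set set \<Rightarrow> 'a set \<Rightarrow> 'a set set set \<Rightarrow> bool" where
  "sphere_tiling E V F \<longleftrightarrow> tiling {} E V F \<and> card F + card V = card E + 2"

lemma disc_tiling_single_face:
  assumes "circuit C"
  shows "disc_tiling C {} {} {C}"
proof -
  have "tiling C {} {} {C}"
  proof
    fix e assume "e \<in> C"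
    then have "{D \<in> {C}. e \<in> D} = {C}" by auto
    then show "card {D \<in> {C}. e \<in> D} = 1" by simp
  qed (use assms link_connected_singleton in auto)
  then show ?thesis by (simp add: disc_tiling_def)
qed

locale tiling_pair = t1: tiling C1 I1 J1 F1 + t2: tiling C2 I2 J2 F2
  for C1 I1 J1 F1 C2 I2 J2 F2 +
  assumes common_edges: "(C1 \<union> I1) \<inter> (C2 \<union> I2) = C1 \<inter> C2"
    and common_vertices: "(\<Union>C1 \<union> J1) \<inter> (\<Union>C2 \<union> J2) \<subseteq> \<Union>(C1 \<inter> C2)"
    and glued: "C1 \<inter> C2 \<noteq> {}"
    and nondegenerate: "\<not> (C1 = C2 \<and> I1 = {} \<and> I2 = {})"
begin

lemma inner_edges_apart: "I1 \<inter> (C2 \<union> I2) = {}" "I2 \<inter> (C1 \<union> I1) = {}"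
  using common_edges t1.boundary_inner_edges t2.boundary_inner_edges by blast+

lemma inner_vertices_apart: "J1 \<inter> \<Union>C2 = {}" "J2 \<inter> \<Union>C1 = {}"
  using common_vertices t1.boundary_inner_vertices t2.boundary_inner_vertices by blast+

lemma faces_disjoint: "F1 \<inter> F2 = {}"
proof (rule equals0I)
  fix D assume D: "D \<in> F1 \<inter> F2"
  then have "D \<inter> I1 = {}" "D \<inter> I2 = {}"
    using t1.face_edges[of D] t2.face_edges[of D] inner_edges_apart by blast+
  then have "D = C1 \<and> I1 = {}" "D = C2 \<and> I2 = {}"
    using D t1.face_within_boundary t2.face_within_boundary by blast+
  then show False using nondegenerate by simp
qed

lemma card_faces: "card (F1 \<union> F2) = card F1 + card F2"
  using card_Un_disjoint[OF t1.finite_faces t2.finite_faces faces_disjoint] .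

lemma card_faces_at_edge:
  "card {D \<in> F1 \<union> F2. e \<in> D} = card {D \<in> F1. e \<in> D} + card {D \<in> F2. e \<in> D}"
proof -
  have "{D \<in> F1 \<union> F2. e \<in> D} = {D \<in> F1. e \<in> D} \<union> {D \<in> F2. e \<in> D}" by blast
  then show ?thesis
    using faces_disjoint t1.finite_faces t2.finite_faces
    by (simp add: card_Un_disjoint disjoint_iff)
qed

lemma link_connected_faces: "link_connected (F1 \<union> F2) y"
proof (rule link_connected_Un[OF t1.link t2.link])
  assume "y \<in> \<Union>(\<Union>F1)" "y \<in> \<Union>(\<Union>F2)"
  then have "y \<in> \<Union>C1 \<union> J1" "y \<in> \<Union>C2 \<union> J2"
    using t1.face_vertices t2.face_vertices by blast+
  then obtain e where e: "y \<in> e" "e \<in> C1" "e \<in> C2" using common_vertices by blast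
  then show "\<exists>D1\<in>F1. \<exists>D2\<in>F2. \<exists>e\<in>D1 \<inter> D2. y \<in> e"
    using t1.face_at_boundary_edge[OF e(2)] t2.face_at_boundary_edge[OF e(3)] by (metis IntI)
qed

theorem tiling_Un:
  defines "C \<equiv> C1 - C2 \<union> (C2 - C1)"
  shows "tiling C (I1 \<union> I2 \<union> (C1 \<inter> C2)) (J1 \<union> J2 \<union> (\<Union>(C1 \<inter> C2) - \<Union>C)) (F1 \<union> F2)"
proof
  show "finite (F1 \<union> F2)" using t1.finite_faces t2.finite_faces by simp
  show "C \<inter> (I1 \<union> I2 \<union> (C1 \<inter> C2)) = {}"
    using inner_edges_apart t1.boundary_inner_edges t2.boundary_inner_edges unfolding C_def by blast
  show "\<Union>C \<inter> (J1 \<union> J2 \<union> (\<Union>(C1 \<inter> C2) - \<Union>C)) = {}"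
    using inner_vertices_apart t1.boundary_inner_vertices t2.boundary_inner_vertices
    unfolding C_def by blast
  fix D assume D: "D \<in> F1 \<union> F2"
  show "circuit D" using D t1.face_circuit t2.face_circuit by blast
  show "D \<subseteq> C \<union> (I1 \<union> I2 \<union> (C1 \<inter> C2))"
    using D t1.face_edges t2.face_edges unfolding C_def by blast
  have "\<Union>D \<subseteq> \<Union>C1 \<union> J1 \<or> \<Union>D \<subseteq> \<Union>C2 \<union> J2"
    using D t1.face_vertices[of D] t2.face_vertices[of D] by blast
  moreover have "\<Union>C1 \<union> \<Union>C2 \<subseteq> \<Union>C \<union> \<Union>(C1 \<inter> C2)" unfolding C_def by blast
  ultimately show "\<Union>D \<subseteq> \<Union>C \<union> (J1 \<union> J2 \<union> (\<Union>(C1 \<inter> C2) - \<Union>C))" by blast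
  show "D = C \<and> I1 \<union> I2 \<union> (C1 \<inter> C2) = {}" if "D \<inter> (I1 \<union> I2 \<union> (C1 \<inter> C2)) = {}"
    using that D t1.face_within_boundary[of D] t2.face_within_boundary[of D] glued by blast
next
  fix e assume "e \<in> I1 \<union> I2 \<union> (C1 \<inter> C2)"
  then consider "e \<in> I1" "e \<notin> C2" "e \<notin> I2" | "e \<in> I2" "e \<notin> C1" "e \<notin> I1" | "e \<in> C1" "e \<in> C2"
    using inner_edges_apart by blast
  then show "card {D \<in> F1 \<union> F2. e \<in> D} = 2"
    unfolding card_faces_at_edge
    by cases (simp_all add: t1.faces_at_inner_edge t2.faces_at_inner_edge t1.faces_at_outer_edge
        t2.faces_at_outer_edge t1.faces_at_boundary_edge t2.faces_at_boundary_edge)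
next
  fix e assume "e \<in> C"
  then consider "e \<in> C1" "e \<notin> C2" "e \<notin> I2" | "e \<in> C2" "e \<notin> C1" "e \<notin> I1"
    using inner_edges_apart unfolding C_def by blast
  then show "card {D \<in> F1 \<union> F2. e \<in> D} = 1"
    unfolding card_faces_at_edge
    by cases (simp_all add: t1.faces_at_boundary_edge t2.faces_at_boundary_edge
        t1.faces_at_outer_edge t2.faces_at_outer_edge)
qed (rule link_connected_faces)

end

lemma sphere_tiling_of_discs:
  assumes C: "circuit C" and tilings: "disc_tiling C I1 J1 F1" "disc_tiling C I2 J2 F2"
    and apart: "I1 \<inter> I2 = {}" "J1 \<inter> J2 = {}" and inner: "I1 \<union> I2 \<noteq> {}"
    and finite: "finite I1" "finite I2" "finite J1" "finite J2"
  shows "sphere_tiling (C \<union> I1 \<union> I2) (\<Union>C \<union> J1 \<union> J2) (F1 \<union> F2)"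
proof -
  interpret t1: tiling C I1 J1 F1 using tilings(1) by (simp add: disc_tiling_def)
  interpret t2: tiling C I2 J2 F2 using tilings(2) by (simp add: disc_tiling_def)
  have "C \<noteq> {}" using circuit_card(2)[OF C] by auto
  then interpret tiling_pair C I1 J1 F1 C I2 J2 F2
    using t1.boundary_inner_edges t2.boundary_inner_edges apart inner by unfold_locales auto
  have "tiling {} (C \<union> I1 \<union> I2) (\<Union>C \<union> J1 \<union> J2) (F1 \<union> F2)"
    using tiling_Un by (simp add: Un_commute Un_left_commute)
  moreover have "card (C \<union> I1 \<union> I2) = card C + card I1 + card I2"
    using t1.boundary_inner_edges t2.boundary_inner_edges apart(1) circuit_finite(1)[OF C] finite
    by (simp add: card_Un_disjoint Int_Un_distrib2)
  moreover have "card (\<Union>C \<union> J1 \<union> J2) = card (\<Union>C) + card J1 + card J2"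
    using t1.boundary_inner_vertices t2.boundary_inner_vertices apart(2)
      circuit_finite(2)[OF C] finite
    by (simp add: card_Un_disjoint Int_Un_distrib2)
  ultimately show ?thesis
    using tilings card_faces circuit_card(1)[OF C] by (simp add: disc_tiling_def sphere_tiling_def)
qed

section \<open>The faces of a plane graph\<close>

context drawing
begin

abbreviation tiles_inside :: "'a set set set \<Rightarrow> 'a set set \<Rightarrow> bool" where
  "tiles_inside F C \<equiv> disc_tiling C (inner_edges C) (inner_vertices C) F"

end

locale drawn_theta = drawing V E p \<gamma>
  for V :: "'a set" and E p \<gamma> +
  fixes a b :: 'a and xs ys zs :: "'a list"
  assumes vertices_distinct: "distinct (a # b # xs @ ys @ zs)"
    and edges_disjoint: "path_via a xs b \<inter> path_via a ys b = {}"
      "path_via a xs b \<inter> path_via a zs b = {}" "path_via a ys b \<inter> path_via a zs b = {}"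
    and edges_subset: "path_via a xs b \<subseteq> E" "path_via a ys b \<subseteq> E" "path_via a zs b \<subseteq> E"
    and chord_inside: "path_via a zs b \<inter> inner_edges (path_via a xs b \<union> path_via a ys b) \<noteq> {}"
begin

abbreviation left :: "'a set set" where "left \<equiv> path_via a xs b"
abbreviation right :: "'a set set" where "right \<equiv> path_via a ys b"
abbreviation chord :: "'a set set" where "chord \<equiv> path_via a zs b"

lemma circuits: "circuit (left \<union> right)" "circuit (left \<union> chord)" "circuit (right \<union> chord)"
  using vertices_distinct by (auto intro!: circuit_Un_path_via edges_disjoint)

lemma inside_split:
  shows "inside (curve (left \<union> chord)) \<inter> inside (curve (right \<union> chord)) = {}"
    and "inside (curve (left \<union> right)) =
      inside (curve (left \<union> chord)) \<union> inside (curve (right \<union> chord)) \<union> (curve chord - {p a, p b})"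
proof -
  have dist: "distinct (a # xs @ [b])" "distinct (a # ys @ [b])" "distinct (a # zs @ [b])"
    using vertices_distinct by auto
  obtain f where f: "arc f" "pathstart f = p a" "pathfinish f = p b" "path_image f = curve left"
    using path_via_arc[OF dist(1) edges_subset(1)] .
  obtain g where g: "arc g" "pathstart g = p a" "pathfinish g = p b" "path_image g = curve right"
    using path_via_arc[OF dist(2) edges_subset(2)] .
  obtain h where h: "arc h" "pathstart h = p a" "pathfinish h = p b" "path_image h = curve chord"
    using path_via_arc[OF dist(3) edges_subset(3)] .
  have meet: "curve left \<inter> curve right = {p a, p b}" "curve left \<inter> curve chord = {p a, p b}"
    "curve right \<inter> curve chord = {p a, p b}"
    using vertices_distinct
    by (simp_all add: curve_path_via_Int edges_disjoint edges_subset Int_Un_distrib)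
  obtain e where e: "e \<in> chord" "e \<in> inner_edges (left \<union> right)" using chord_inside by blast
  then have "mid e \<in> curve chord" "mid e \<in> inside (curve left \<union> curve right)"
    using mid_in_curve_iff[OF edges_subset(3), of e] by (auto simp: inner_edges_def curve_Un)
  then have enters: "path_image h \<inter> inside (path_image f \<union> path_image g) \<noteq> {}"
    unfolding f(4) g(4) h(4) by blast
  have "p a \<noteq> p b" using arc_distinct_ends[OF f(1)] f(2,3) by simp
  then have "inside (curve left \<union> curve chord) \<inter> inside (curve right \<union> curve chord) = {}"
    "inside (curve left \<union> curve chord) \<union> inside (curve right \<union> curve chord) \<union>
      (curve chord - {p a, p b}) = inside (curve left \<union> curve right)"
    using split_inside_simple_closed_curve[of f "p a" "p b" g h] f g h meet enters
    by (auto simp: arc_imp_simple_path)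
  then show "inside (curve (left \<union> chord)) \<inter> inside (curve (right \<union> chord)) = {}"
    and "inside (curve (left \<union> right)) =
      inside (curve (left \<union> chord)) \<union> inside (curve (right \<union> chord)) \<union> (curve chord - {p a, p b})"
    by (simp_all add: curve_Un)
qed

lemma ends_vertices: "a \<in> V" "b \<in> V"
  using Union_edges_subset[OF edges_subset(1)] by auto

lemma inner_edges_split:
  shows "inner_edges (left \<union> chord) \<inter> inner_edges (right \<union> chord) = {}"
    and "inner_edges (left \<union> right) =
      inner_edges (left \<union> chord) \<union> inner_edges (right \<union> chord) \<union> chord"
proof -
  show "inner_edges (left \<union> chord) \<inter> inner_edges (right \<union> chord) = {}"
    using inside_split(1) by (auto simp: inner_edges_def)
  have "mid e \<in> curve chord - {p a, p b} \<longleftrightarrow> e \<in> chord" if "e \<in> E" for e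
    using mid_in_curve_iff[OF edges_subset(3) that] mid_not_vertex[OF that] ends_vertices by auto
  then show "inner_edges (left \<union> right) =
      inner_edges (left \<union> chord) \<union> inner_edges (right \<union> chord) \<union> chord"
    using edges_subset(3) unfolding inner_edges_def inside_split(2) by blast
qed

lemma inner_vertices_split:
  shows "inner_vertices (left \<union> chord) \<inter> inner_vertices (right \<union> chord) = {}"
    and "inner_vertices (left \<union> right) =
      inner_vertices (left \<union> chord) \<union> inner_vertices (right \<union> chord) \<union> set zs"
proof -
  show "inner_vertices (left \<union> chord) \<inter> inner_vertices (right \<union> chord) = {}"
    using inside_split(1) by (auto simp: inner_vertices_def)
  have "p v \<in> curve chord - {p a, p b} \<longleftrightarrow> v \<in> set zs" if "v \<in> V" for v
  proof -
    have "p v = p a \<longleftrightarrow> v = a" "p v = p b \<longleftrightarrow> v = b"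
      using inj_on_eq_iff[OF inj_vertices that] ends_vertices by auto
    then show ?thesis
      using vertex_in_curve_iff[OF edges_subset(3) that] vertices_distinct by auto
  qed
  moreover have "set zs \<subseteq> V" using Union_edges_subset[OF edges_subset(3)] by auto
  ultimately show "inner_vertices (left \<union> right) =
      inner_vertices (left \<union> chord) \<union> inner_vertices (right \<union> chord) \<union> set zs"
    unfolding inner_vertices_def inside_split(2) by blast
qed

lemma Int_theta_circuits: "(left \<union> chord) \<inter> (right \<union> chord) = chord"
  using edges_disjoint(1) by blast

lemma theta_circuits_subset: "left \<union> right \<subseteq> E" "left \<union> chord \<subseteq> E" "right \<union> chord \<subseteq> E"
  using edges_subset by auto

lemma inner_edges_psubset:
  "inner_edges (left \<union> chord) \<subset> inner_edges (left \<union> right)"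
  "inner_edges (right \<union> chord) \<subset> inner_edges (left \<union> right)"
  using inner_edges_split(2) inner_edges_disjoint theta_circuits_subset path_via_nonempty[of a zs b]
  by blast+

lemma card_inner_edges_theta:
  "card (inner_edges (left \<union> right)) =
    card (inner_edges (left \<union> chord)) + card (inner_edges (right \<union> chord)) + (length zs + 1)"
proof -
  have "(inner_edges (left \<union> chord) \<union> inner_edges (right \<union> chord)) \<inter> chord = {}"
    using inner_edges_disjoint theta_circuits_subset by blast
  moreover have "card chord = length zs + 1" using vertices_distinct by (simp add: card_path_via)
  ultimately show ?thesis
    unfolding inner_edges_split(2) using inner_edges_split(1) finite_inner(1)
    by (simp add: card_Un_disjoint)
qed

lemma card_inner_vertices_theta:
  "card (inner_vertices (left \<union> right)) =
    card (inner_vertices (left \<union> chord)) + card (inner_vertices (right \<union> chord)) + length zs"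
proof -
  have "(inner_vertices (left \<union> chord) \<union> inner_vertices (right \<union> chord)) \<inter> \<Union>chord = {}"
    using inner_vertices_disjoint[OF theta_circuits_subset(2)]
      inner_vertices_disjoint[OF theta_circuits_subset(3)] by blast
  then have "(inner_vertices (left \<union> chord) \<union> inner_vertices (right \<union> chord)) \<inter> set zs = {}" by auto
  then show ?thesis
    unfolding inner_vertices_split(2)
    using inner_vertices_split(1) finite_inner(2) vertices_distinct
    by (simp add: card_Un_disjoint distinct_card)
qed

lemma tiling_pair_theta:
  assumes "tiles_inside F1 (left \<union> chord)" "tiles_inside F2 (right \<union> chord)"
  shows "tiling_pair (left \<union> chord) (inner_edges (left \<union> chord)) (inner_vertices (left \<union> chord)) F1
    (right \<union> chord) (inner_edges (right \<union> chord)) (inner_vertices (right \<union> chord)) F2"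
proof -
  let ?E1 = "inner_edges (left \<union> chord)" and ?E2 = "inner_edges (right \<union> chord)"
  let ?V1 = "inner_vertices (left \<union> chord)" and ?V2 = "inner_vertices (right \<union> chord)"
  note edges = theta_circuits_subset[THEN inner_edges_disjoint]
  note vertices = theta_circuits_subset[THEN inner_vertices_disjoint]
  have "((left \<union> chord) \<union> ?E1) \<inter> ((right \<union> chord) \<union> ?E2) = (left \<union> chord) \<inter> (right \<union> chord)"
    using edges inner_edges_split by blast
  moreover have "?V1 \<inter> \<Union>(right \<union> chord) = {}" "?V2 \<inter> \<Union>(left \<union> chord) = {}"
    using vertices inner_vertices_split(2) unfolding Union_Un_distrib by blast+
  then have "(\<Union>(left \<union> chord) \<union> ?V1) \<inter> (\<Union>(right \<union> chord) \<union> ?V2)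
      \<subseteq> \<Union>(left \<union> chord) \<inter> \<Union>(right \<union> chord)"
    using inner_vertices_split(1) by blast
  then have "(\<Union>(left \<union> chord) \<union> ?V1) \<inter> (\<Union>(right \<union> chord) \<union> ?V2)
      \<subseteq> \<Union>((left \<union> chord) \<inter> (right \<union> chord))"
    unfolding Int_theta_circuits using vertices_distinct by auto
  moreover have "left \<union> chord \<noteq> right \<union> chord"
    using edges_disjoint path_via_nonempty[of a xs b] by blast
  ultimately show ?thesis
    using assms
    by (simp add: disc_tiling_def tiling_pair_def tiling_pair_axioms_def Int_theta_circuits)
qed

lemma tiles_inside_theta:
  assumes tilings: "tiles_inside F1 (left \<union> chord)" "tiles_inside F2 (right \<union> chord)"
  shows "tiles_inside (F1 \<union> F2) (left \<union> right)"
proof -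
  interpret tiling_pair
    "left \<union> chord" "inner_edges (left \<union> chord)" "inner_vertices (left \<union> chord)" F1
    "right \<union> chord" "inner_edges (right \<union> chord)" "inner_vertices (right \<union> chord)" F2
    using tilings by (rule tiling_pair_theta)
  have "(left \<union> chord) - (right \<union> chord) \<union> ((right \<union> chord) - (left \<union> chord)) = left \<union> right"
    using edges_disjoint by blast
  moreover have "\<Union>chord - \<Union>(left \<union> right) = set zs" using vertices_distinct by auto
  ultimately have "tiling (left \<union> right)
      (inner_edges (left \<union> right)) (inner_vertices (left \<union> right)) (F1 \<union> F2)"
    using tiling_Un
    unfolding Int_theta_circuits inner_edges_split(2) inner_vertices_split(2) by simp
  then show ?thesis
    using tilings card_faces card_inner_edges_theta card_inner_vertices_theta
    by (simp add: disc_tiling_def)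
qed

end

context drawing
begin

lemma drawn_theta_exists:
  assumes "biconnected V E" and C: "circuit C" "C \<subseteq> E" and "inner_edges C \<noteq> {}"
  obtains a b xs ys zs where "drawn_theta V E p \<gamma> a b xs ys zs"
    "C = path_via a xs b \<union> path_via a ys b"
proof -
  obtain a b zs where ab: "a \<in> \<Union>C" "b \<in> \<Union>C"
      and chord: "distinct (a # zs @ [b])" "set zs \<inter> \<Union>C = {}" "path_via a zs b \<subseteq> E"
        "path_via a zs b \<inter> C = {}" "path_via a zs b \<inter> inner_edges C \<noteq> {}"
    using chord_inside_exists[OF assms] .
  have "a \<noteq> b" using chord(1) by simp
  obtain xs ys where halves: "distinct (a # b # xs @ ys)"
      "path_via a xs b \<inter> path_via a ys b = {}" "C = path_via a xs b \<union> path_via a ys b"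
    using circuit_split[OF C(1) ab \<open>a \<noteq> b\<close>] .
  have "distinct (a # b # xs @ ys @ zs)" using halves(1,3) chord(1,2) by auto
  then have "drawn_theta V E p \<gamma> a b xs ys zs"
    using halves(2,3) chord(3-5) C(2) by unfold_locales auto
  then show thesis using halves(3) by (rule that)
qed

lemma inner_vertices_empty:
  assumes "V \<subseteq> \<Union>E" "C \<subseteq> E" "inner_edges C = {}"
  shows "inner_vertices C = {}"
proof (rule equals0I)
  fix x assume x: "x \<in> inner_vertices C"
  then obtain e where "e \<in> E" "x \<in> e" using assms(1) by (auto simp: inner_vertices_def)
  moreover have "x \<notin> \<Union>C" using x inner_vertices_disjoint[OF assms(2)] by blast
  ultimately show False using inner_vertex_iff_inner_edge[OF assms(2)] x assms(3) by blast
qed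

theorem inside_tiling_exists:
  assumes bi: "biconnected V E" and no_isolated: "V \<subseteq> \<Union>E" and C: "circuit C" "C \<subseteq> E"
  shows "\<exists>F. tiles_inside F C"
  using C
proof (induction "card (inner_edges C)" arbitrary: C rule: less_induct)
  case less
  show ?case
  proof (cases "inner_edges C = {}")
    case True
    then show ?thesis
      using disc_tiling_single_face[OF less.prems(1)]
        inner_vertices_empty[OF no_isolated less.prems(2)] by (intro exI[of _ "{C}"]) simp
  next
    case False
    obtain a b xs ys zs where theta: "drawn_theta V E p \<gamma> a b xs ys zs"
        and C: "C = path_via a xs b \<union> path_via a ys b"
      using drawn_theta_exists[OF bi less.prems False] .
    interpret drawn_theta V E p \<gamma> a b xs ys zs by (rule theta)
    have smaller: "card (inner_edges (left \<union> chord)) < card (inner_edges C)"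
      "card (inner_edges (right \<union> chord)) < card (inner_edges C)"
      unfolding C using inner_edges_psubset finite_inner(1) psubset_card_mono by blast+
    obtain F1 where "tiles_inside F1 (left \<union> chord)"
      using less.hyps[OF smaller(1) circuits(2) theta_circuits_subset(2)] by blast
    moreover obtain F2 where "tiles_inside F2 (right \<union> chord)"
      using less.hyps[OF smaller(2) circuits(3) theta_circuits_subset(3)] by blast
    ultimately show ?thesis unfolding C using tiles_inside_theta by blast
  qed
qed

end

text \<open>A circuit \<open>E\<close> on its own is excluded because its two faces have the same edges.\<close>

theorem sphere_tiling_exists:
  assumes simple: "simple_graph V E" and planar: "planar_graph V E" and bi: "biconnected V E"
    and "V \<noteq> {}" and degree: "\<And>v. v \<in> V \<Longrightarrow> 2 \<le> vertex_degree E v" and "\<not> circuit E"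
  shows "\<exists>F. sphere_tiling E V F"
proof -
  obtain p \<gamma> where "drawing V E p \<gamma>" using planar_graph_drawing[OF simple planar] .
  then interpret drawing V E p \<gamma> .
  obtain C where C: "circuit C" "C \<subseteq> E"
    using biconnected_circuit_exists[OF bi simple degree] \<open>V \<noteq> {}\<close> by blast
  have no_isolated: "V \<subseteq> \<Union>E"
  proof
    fix v assume "v \<in> V"
    then have "{e \<in> E. v \<in> e} \<noteq> {}" using degree[of v] unfolding vertex_degree_def by force
    then show "v \<in> \<Union>E" by blast
  qed
  define I J where "I = E - C - inner_edges C" and "J = V - \<Union>C - inner_vertices C"
  obtain F1 where F1: "tiles_inside F1 C" using inside_tiling_exists[OF bi no_isolated C] by blast
  obtain q \<delta> where inverted: "drawing V E q \<delta>" "drawing.inner_edges E \<delta> C = I"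
      "drawing.inner_vertices V q \<delta> C = J"
    unfolding I_def J_def using inverted_drawing_exists[OF C] .
  then obtain F2 where F2: "disc_tiling C I J F2"
    using drawing.inside_tiling_exists[OF inverted(1) bi no_isolated C] by auto
  have E: "C \<union> inner_edges C \<union> I = E" and V: "\<Union>C \<union> inner_vertices C \<union> J = V"
    using C(2) Union_edges_subset[OF C(2)]
    by (auto simp: I_def J_def inner_edges_def inner_vertices_def)
  have "inner_edges C \<union> I \<noteq> {}" using E C(1) \<open>\<not> circuit E\<close> by auto
  moreover have "inner_edges C \<inter> I = {}" "inner_vertices C \<inter> J = {}" by (auto simp: I_def J_def)
  moreover have "finite I" "finite J"
    using simple_graph_finite[OF simple] by (simp_all add: I_def J_def)
  ultimately have "sphere_tiling (C \<union> inner_edges C \<union> I) (\<Union>C \<union> inner_vertices C \<union> J) (F1 \<union> F2)"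
    using finite_inner by (intro sphere_tiling_of_discs[OF C(1) F1 F2])
  then show ?thesis unfolding E V by blast
qed

section \<open>Discharging\<close>

context tiling
begin

lemma faces_sharing_edge:
  assumes "D1 \<in> F" "D2 \<in> F" "D1 \<noteq> D2" "e \<in> D1 \<inter> D2"
  shows "{D \<in> F. e \<in> D} = {D1, D2}"
proof (rule card_seteq[symmetric])
  show "finite {D \<in> F. e \<in> D}" using finite_faces by simp
  show "{D1, D2} \<subseteq> {D \<in> F. e \<in> D}" using assms by auto
  have "e \<in> C \<or> e \<in> I" using face_edges[OF assms(1)] assms(4) by blast
  then show "card {D \<in> F. e \<in> D} \<le> card {D1, D2}"
    using faces_at_inner_edge[of e] faces_at_boundary_edge[of e] assms(3) by auto
qed

lemma faces_at_vertex_of_shared_edges: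
  assumes D: "D1 \<in> F" "D2 \<in> F" "D1 \<noteq> D2"
    and e: "e1 \<in> D1 \<inter> D2" "e2 \<in> D1 \<inter> D2" "e1 \<noteq> e2" and y: "y \<in> e1 \<inter> e2"
    and face: "D \<in> F" "y \<in> \<Union>D"
  shows "D = D1 \<or> D = D2"
proof (rule ccontr)
  assume "\<not> ?thesis"
  then have other: "D \<in> F - {D1, D2}" using face(1) by blast
  have "{D1, D2} \<union> (F - {D1, D2}) = F" using D by auto
  moreover have "D1 \<in> {D1, D2}" "y \<in> \<Union>D1" using e y by auto
  ultimately obtain D' H d where shared: "D' \<in> {D1, D2}" "H \<in> F - {D1, D2}" "d \<in> D'" "d \<in> H" "y \<in> d"
    by (rule link_connectedD[OF link _ _ _ other face(2)])
  have "circuit D'" "e1 \<in> D'" "e2 \<in> D'" using shared(1) D e face_circuit by auto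
  then have "{d \<in> D'. y \<in> d} = {e1, e2}" using circuit_incident_eq e(3) y by metis
  moreover have "d \<in> {d \<in> D'. y \<in> d}" using shared(3,5) by simp
  ultimately have "d \<in> {e1, e2}" by simp
  then have "d \<in> D1 \<inter> D2" using e(1,2) by blast
  then have "{D \<in> F. d \<in> D} = {D1, D2}" using faces_sharing_edge[OF D] by simp
  then show False using shared(2,4) by auto
qed

lemma shared_edges_inner_degree:
  assumes D: "D1 \<in> F" "D2 \<in> F" "D1 \<noteq> D2"
    and e: "e1 \<in> D1 \<inter> D2" "e2 \<in> D1 \<inter> D2" "e1 \<noteq> e2" and y: "y \<in> e1 \<inter> e2"
  shows "vertex_degree I y \<le> 2"
proof -
  have "{d \<in> I. y \<in> d} \<subseteq> {e1, e2}"
  proof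
    fix d assume d: "d \<in> {d \<in> I. y \<in> d}"
    then have "{D \<in> F. d \<in> D} \<noteq> {}" using faces_at_inner_edge[of d] by force
    then obtain D where D': "D \<in> F" "d \<in> D" by blast
    then have "D = D1 \<or> D = D2" using faces_at_vertex_of_shared_edges[OF assms, of D] d by blast
    then have "e1 \<in> D" "e2 \<in> D" using e by auto
    then have "{d \<in> D. y \<in> d} = {e1, e2}"
      using circuit_incident_eq[OF face_circuit[OF D'(1)]] e(3) y by metis
    then show "d \<in> {e1, e2}" using D'(2) d by auto
  qed
  then have "vertex_degree I y \<le> card {e1, e2}"
    unfolding vertex_degree_def by (intro card_mono) auto
  then show ?thesis using e(3) by simp
qed

lemma other_face:
  assumes "e \<in> I"
  obtains D' where "D' \<in> F" "D' \<noteq> D" "e \<in> D'"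
proof -
  have "\<not> {D' \<in> F. e \<in> D'} \<subseteq> {D}"
    using faces_at_inner_edge[OF assms] card_mono[of "{D}" "{D' \<in> F. e \<in> D'}"] by auto
  then show thesis using that by blast
qed

end

definition triangle_sparse :: "'a set \<Rightarrow> 'a set set \<Rightarrow> bool" where
  "triangle_sparse V E \<longleftrightarrow>
     (\<forall>T1 T2. triangle V E T1 \<and> triangle V E T2 \<and> T1 \<noteq> T2 \<longrightarrow> \<not> intersecting_cycles T1 T2) \<and>
     (\<forall>T. triangle V E T \<longrightarrow> card {Q. is_cycle V E 4 Q \<and> adjacent_cycles T Q} \<le> 1)"

lemma finite_cycles:
  assumes "simple_graph V E"
  shows "finite {Q. is_cycle V E k Q \<and> P Q}"
  by (rule finite_subset[of _ "Pow E"])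
    (use simple_graph_finite(2)[OF assms] in \<open>auto simp: is_cycle_def\<close>)

lemma triangle_sparse_mono:
  assumes sparse: "triangle_sparse V E" and simple: "simple_graph V E" and sub: "V' \<subseteq> V" "E' \<subseteq> E"
  shows "triangle_sparse V' E'"
  unfolding triangle_sparse_def
proof (intro conjI allI impI)
  note cycle = is_cycle_mono[OF _ sub]
  fix T1 T2 assume "triangle V' E' T1 \<and> triangle V' E' T2 \<and> T1 \<noteq> T2"
  then show "\<not> intersecting_cycles T1 T2" using sparse cycle unfolding triangle_sparse_def by metis
next
  note cycle = is_cycle_mono[OF _ sub]
  fix T assume T: "triangle V' E' T"
  have "card {Q. is_cycle V' E' 4 Q \<and> adjacent_cycles T Q}
      \<le> card {Q. is_cycle V E 4 Q \<and> adjacent_cycles T Q}"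
    using cycle by (intro card_mono finite_cycles[OF simple]) auto
  also have "\<dots> \<le> 1" using sparse cycle[OF T] unfolding triangle_sparse_def by metis
  finally show "card {Q. is_cycle V' E' 4 Q \<and> adjacent_cycles T Q} \<le> 1" .
qed

definition charged_edges :: "'a set set \<Rightarrow> 'a set" where
  "charged_edges F = {e. (\<exists>D\<in>F. card D = 3 \<and> e \<in> D) \<and> (\<exists>D\<in>F. 5 \<le> card D \<and> e \<in> D)}"

text \<open>A charged edge passes 1/2 from its long face to its triangular one; all quantities are
  doubled.\<close>

lemma four_card_le_sum_card:
  assumes finite: "finite F" and card_ge: "\<And>D. D \<in> F \<Longrightarrow> 3 \<le> card D"
    and disjoint: "\<And>D D'. D \<in> F \<Longrightarrow> D' \<in> F \<Longrightarrow> card D = 3 \<Longrightarrow> card D' = 3 \<Longrightarrow> D \<noteq> D' \<Longrightarrow> D \<inter> D' = {}"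
    and receive: "\<And>D. D \<in> F \<Longrightarrow> card D = 3 \<Longrightarrow> 2 \<le> card (D \<inter> charged_edges F)"
    and pay: "\<And>D. D \<in> F \<Longrightarrow> 5 \<le> card D \<Longrightarrow> 2 * card (D \<inter> charged_edges F) \<le> card D"
  shows "4 * card F \<le> (\<Sum>D\<in>F. card D)"
proof -
  define charge where "charge D = card (D \<inter> charged_edges F)" for D
  let ?T = "{D \<in> F. card D = 3}" and ?B = "{D \<in> F. 5 \<le> card D}"
  have finite_face: "finite D" if "D \<in> F" for D
    using card_ge[OF that] by (auto intro: card_ge_0_finite)
  have "(\<Sum>D\<in>?T. charge D) = card (\<Union>D\<in>?T. D \<inter> charged_edges F)"
    unfolding charge_def
    using finite finite_face disjoint by (intro card_UN_disjoint[symmetric]) auto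
  also have "\<dots> \<le> card (\<Union>D\<in>?B. D \<inter> charged_edges F)"
    using finite finite_face by (intro card_mono) (auto simp: charged_edges_def)
  also have "\<dots> \<le> (\<Sum>D\<in>?B. charge D)"
    unfolding charge_def using finite by (intro card_UN_le) simp
  finally have balance: "(\<Sum>D\<in>?T. charge D) \<le> (\<Sum>D\<in>?B. charge D)" .
  have "8 + (if 5 \<le> card D then charge D else 0)
      \<le> 2 * card D + (if card D = 3 then charge D else 0)"
    if "D \<in> F" for D
    using card_ge[OF that] receive[OF that] pay[OF that] unfolding charge_def by auto
  then have "(\<Sum>D\<in>F. 8 + (if 5 \<le> card D then charge D else 0))
      \<le> (\<Sum>D\<in>F. 2 * card D + (if card D = 3 then charge D else 0))" by (rule sum_mono)
  then have "8 * card F + (\<Sum>D\<in>?B. charge D) \<le> 2 * (\<Sum>D\<in>F. card D) + (\<Sum>D\<in>?T. charge D)"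
    using finite by (simp add: sum.distrib sum_distrib_left sum.inter_filter)
  then show ?thesis using balance by linarith
qed

locale sparse_map = tiling "{}" E V F for E V F +
  assumes simple: "simple_graph V E"
    and min_degree: "v \<in> V \<Longrightarrow> 3 \<le> vertex_degree E v"
    and sparse: "triangle_sparse V E"
begin

lemma face_is_cycle: "D \<in> F \<Longrightarrow> is_cycle V E (card D) D"
  using face_circuit[of D] face_edges[of D] face_vertices[of D] by (simp add: is_cycle_iff_circuit)

lemma face_subset: "D \<in> F \<Longrightarrow> D \<subseteq> E"
  using face_edges by simp

lemma shared_edges_disjoint:
  assumes "D1 \<in> F" "D2 \<in> F" "D1 \<noteq> D2" "e1 \<in> D1 \<inter> D2" "e2 \<in> D1 \<inter> D2" "e1 \<noteq> e2"
  shows "e1 \<inter> e2 = {}"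
proof (rule equals0I)
  fix y assume y: "y \<in> e1 \<inter> e2"
  have "y \<in> V" using face_vertices[OF assms(1)] assms(4) y by auto
  then show False using min_degree shared_edges_inner_degree[OF assms y] by force
qed

lemma triangular_faces_disjoint:
  assumes "D1 \<in> F" "D2 \<in> F" "card D1 = 3" "card D2 = 3" "D1 \<noteq> D2"
  shows "\<Union>D1 \<inter> \<Union>D2 = {}"
proof -
  have "\<not> intersecting_cycles D1 D2"
    using sparse assms face_is_cycle unfolding triangle_sparse_def by metis
  then show ?thesis by (simp add: intersecting_cycles_def cycle_vertices_def)
qed

lemma uncharged_triangle_edge:
  assumes D: "D \<in> F" "card D = 3" and e: "e \<in> D" "e \<notin> charged_edges F"
  obtains D' where "D' \<in> F" "D' \<noteq> D" "e \<in> D'" "card D' = 4"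
proof -
  have "e \<in> E" using face_subset D(1) e(1) by blast
  then obtain D' where D': "D' \<in> F" "D' \<noteq> D" "e \<in> D'" by (rule other_face)
  have "e \<noteq> {}" using simple_graph_card_edge[OF simple \<open>e \<in> E\<close>] by auto
  then have "card D' \<noteq> 3" using triangular_faces_disjoint[of D D'] D D' e(1) by blast
  moreover have "\<not> 5 \<le> card D'" using D D' e by (auto simp: charged_edges_def)
  ultimately have "card D' = 4" using circuit_card(2)[OF face_circuit[OF D'(1)]] by linarith
  then show thesis using that D' by blast
qed

lemma triangle_charge:
  assumes D: "D \<in> F" "card D = 3"
  shows "2 \<le> card (D \<inter> charged_edges F)"
proof -
  have "e = e'" if e: "e \<in> D - charged_edges F" and e': "e' \<in> D - charged_edges F" for e e'
  proof (rule ccontr)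
    assume "e \<noteq> e'"
    obtain Q where Q: "Q \<in> F" "Q \<noteq> D" "e \<in> Q" "card Q = 4"
      using uncharged_triangle_edge[OF D] e by blast
    obtain Q' where Q': "Q' \<in> F" "Q' \<noteq> D" "e' \<in> Q'" "card Q' = 4"
      using uncharged_triangle_edge[OF D] e' by blast
    let ?adjacent = "{Q. is_cycle V E 4 Q \<and> adjacent_cycles D Q}"
    have "Q \<in> ?adjacent" "Q' \<in> ?adjacent"
      using e e' Q Q' face_is_cycle[of Q] face_is_cycle[of Q'] by (auto simp: adjacent_cycles_def)
    moreover have "card ?adjacent \<le> Suc 0"
      using sparse face_is_cycle[OF D(1)] D(2) unfolding triangle_sparse_def by simp
    then have "\<forall>Q\<in>?adjacent. \<forall>Q'\<in>?adjacent. Q = Q'"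
      by (simp only: card_le_Suc0_iff_eq finite_cycles[OF simple])
    ultimately have "Q = Q'" by blast
    then have "e \<inter> e' = {}"
      using shared_edges_disjoint[of D Q e e'] D(1) Q Q'(3) e e' \<open>e \<noteq> e'\<close> by auto
    moreover have "e \<in> E" "e' \<in> E" using face_subset[OF D(1)] e e' by auto
    ultimately have "card (e \<union> e') = 4"
      using simple_graph_card_edge[OF simple] by (simp add: card_Un_disjoint card_ge_0_finite)
    moreover have "card (e \<union> e') \<le> card (\<Union>D)"
      using e e' circuit_finite(2)[OF face_circuit[OF D(1)]] by (intro card_mono) auto
    ultimately show False using circuit_card(1)[OF face_circuit[OF D(1)]] D(2) by simp
  qed
  moreover have fin: "finite D" using circuit_finite(1)[OF face_circuit[OF D(1)]] .
  ultimately have "card (D - charged_edges F) \<le> 1"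
    by (metis card_le_Suc0_iff_eq One_nat_def finite_Diff)
  then show ?thesis using card_Int_Diff[OF fin, of "charged_edges F"] D(2) by simp
qed

lemma charged_edges_disjoint:
  assumes D: "D \<in> F" "5 \<le> card D"
    and e: "e \<in> D \<inter> charged_edges F" "e' \<in> D \<inter> charged_edges F" "e \<noteq> e'"
  shows "e \<inter> e' = {}"
proof -
  obtain T T' where T: "T \<in> F" "card T = 3" "e \<in> T" "T' \<in> F" "card T' = 3" "e' \<in> T'"
    using e by (auto simp: charged_edges_def)
  show ?thesis
  proof (cases "T = T'")
    case True
    have "T \<noteq> D" using T(2) D(2) by auto
    then show ?thesis using shared_edges_disjoint[of T D e e'] T D(1) e True by simp
  next
    case False
    then show ?thesis using triangular_faces_disjoint[of T T'] T by blast
  qed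
qed

lemma long_face_charge:
  assumes D: "D \<in> F" "5 \<le> card D"
  shows "2 * card (D \<inter> charged_edges F) \<le> card D"
proof -
  let ?X = "D \<inter> charged_edges F"
  note circ = face_circuit[OF D(1)]
  have card_edge: "card e = 2" if "e \<in> ?X" for e
    using simple_graph_card_edge[OF simple] face_subset[OF D(1)] that by blast
  have "2 * card ?X = (\<Sum>e\<in>?X. card e)" using card_edge by simp
  also have "\<dots> = card (\<Union>?X)"
  proof (rule card_Union_disjoint[symmetric])
    show "pairwise disjnt ?X"
      using charged_edges_disjoint[OF D] by (simp add: pairwise_def disjnt_def)
    show "finite e" if "e \<in> ?X" for e using card_edge[OF that] by (simp add: card_ge_0_finite)
  qed
  also have "\<dots> \<le> card (\<Union>D)" using circuit_finite(2)[OF circ] by (intro card_mono) auto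
  finally show ?thesis using circuit_card(1)[OF circ] by simp
qed

lemma sum_card_faces: "(\<Sum>D\<in>F. card D) = 2 * card E"
proof -
  have "(\<Sum>D\<in>F. card D) = (\<Sum>D\<in>F. card {e \<in> E. e \<in> D})"
    using face_subset by (intro sum.cong) (auto intro!: arg_cong[of _ _ card])
  also have "\<dots> = 2 * card E"
    using faces_at_inner_edge
    by (intro sum_multicount finite_faces simple_graph_finite(2)[OF simple]) simp
  finally show ?thesis .
qed

theorem twice_card_faces_le: "2 * card F \<le> card E"
proof -
  have "4 * card F \<le> (\<Sum>D\<in>F. card D)"
  proof (rule four_card_le_sum_card[OF finite_faces _ _ triangle_charge long_face_charge])
    fix D assume "D \<in> F"
    then show "3 \<le> card D" using circuit_card(2)[OF face_circuit] by simp
  next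
    fix D D' assume D: "D \<in> F" "D' \<in> F" "card D = 3" "card D' = 3" "D \<noteq> D'"
    show "D \<inter> D' = {}"
    proof (rule equals0I)
      fix e assume e: "e \<in> D \<inter> D'"
      then have "e \<noteq> {}" using simple_graph_card_edge[OF simple, of e] face_subset[OF D(1)] by auto
      then show False using triangular_faces_disjoint[OF D] e by blast
    qed
  qed
  then show ?thesis using sum_card_faces by simp
qed

end

theorem planar_triangle_sparse_edge_bound:
  assumes simple: "simple_graph V E" and "planar_graph V E" "triangle_sparse V E" "V \<noteq> {}"
  shows "card E + 2 \<le> 2 * card V"
proof (rule edge_bound_from_blocks[OF simple \<open>V \<noteq> {}\<close>])
  fix W assume W: "W \<subseteq> V" "W \<noteq> {}" and bi: "biconnected W (spanned E W)"
    and degree: "\<And>v. v \<in> W \<Longrightarrow> 2 < vertex_degree (spanned E W) v"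
  have sub: "spanned E W \<subseteq> E" "\<Union>(spanned E W) \<subseteq> W" by (auto simp: spanned_def)
  note simple_W = simple_graph_spanned[OF simple W(1)]
  have "\<not> circuit (spanned E W)"
  proof
    assume circ: "circuit (spanned E W)"
    then obtain y where y: "y \<in> \<Union>(spanned E W)" by (rule circuit_other_vertex)
    then show False
      using circuit_incident[OF circ y] degree[of y] sub(2) by (auto simp: vertex_degree_def)
  qed
  then obtain F where F: "sphere_tiling (spanned E W) W F"
    using sphere_tiling_exists[OF simple_W planar_graph_mono[OF assms(2) W(1) sub] bi W(2)]
      degree less_imp_le by blast
  have "3 \<le> vertex_degree (spanned E W) v" if "v \<in> W" for v using degree[OF that] by simp
  then have "sparse_map (spanned E W) W F"
    using F simple_W triangle_sparse_mono[OF assms(3) simple W(1) sub(1)]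
    by (simp add: sphere_tiling_def sparse_map_def sparse_map_axioms_def)
  then have "2 * card F \<le> card (spanned E W)" by (rule sparse_map.twice_card_faces_le)
  then show "card (spanned E W) + 2 \<le> 2 * card W" using F by (simp add: sphere_tiling_def)
qed

section \<open>Edge assignments\<close>

definition hakimi_condition :: "'a set \<Rightarrow> 'a set set \<Rightarrow> ('a \<Rightarrow> nat) \<Rightarrow> bool" where
  "hakimi_condition V E k \<longleftrightarrow> (\<forall>X\<subseteq>V. card (spanned E X) \<le> sum k X)"

lemma hakimi_conditionD: "hakimi_condition V E k \<Longrightarrow> X \<subseteq> V \<Longrightarrow> card (spanned E X) \<le> sum k X"
  by (simp add: hakimi_condition_def)

definition tight :: "'a set set \<Rightarrow> ('a \<Rightarrow> nat) \<Rightarrow> 'a set \<Rightarrow> bool" where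
  "tight E k X \<longleftrightarrow> card (spanned E X) = sum k X"

lemma tight_Un:
  assumes "finite E" "finite V" "hakimi_condition V E k"
    and "X \<subseteq> V" "Y \<subseteq> V" "tight E k X" "tight E k Y"
  shows "tight E k (X \<union> Y)"
proof -
  have "finite X" "finite Y" using assms finite_subset by metis+
  then have "sum k (X \<union> Y) + sum k (X \<inter> Y) = sum k X + sum k Y" by (rule sum.union_inter)
  moreover have "card (spanned E (X \<union> Y)) \<le> sum k (X \<union> Y)"
    "card (spanned E (X \<inter> Y)) \<le> sum k (X \<inter> Y)"
    using assms(4,5) by (auto intro!: hakimi_conditionD[OF assms(3)])
  ultimately show ?thesis
    using spanned_supermodular[OF assms(1), of X Y] assms(6,7) unfolding tight_def by linarith
qed

lemma tight_superset_exists: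
  assumes "finite E" "finite V" "hakimi_condition V E k"
    and "finite A" and "\<And>a. a \<in> A \<Longrightarrow> \<exists>X\<subseteq>V. a \<in> X \<and> tight E k X"
  shows "A = {} \<or> (\<exists>X\<subseteq>V. A \<subseteq> X \<and> tight E k X)"
  using assms(4,5)
proof (induction A)
  case (insert a A)
  obtain X where X: "X \<subseteq> V" "a \<in> X" "tight E k X" using insert.prems by blast
  from insert consider (empty) "A = {}" | (nonempty) Y where "Y \<subseteq> V" "A \<subseteq> Y" "tight E k Y" by blast
  then show ?case
  proof cases
    case empty
    then show ?thesis using X by blast
  next
    case nonempty
    then have "tight E k (X \<union> Y)" using tight_Un[OF assms(1-3)] X by blast
    then show ?thesis using X nonempty by (intro disjI2 exI[of _ "X \<union> Y"]) auto
  qed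
qed simp

lemma hakimi_condition_decrease:
  assumes "finite V" and hakimi: "hakimi_condition V E k"
    and slack: "\<And>X. X \<subseteq> V \<Longrightarrow> a \<in> X \<Longrightarrow> \<not> tight E k X"
  shows "hakimi_condition V E (k(a := k a - 1))"
  unfolding hakimi_condition_def
proof (intro allI impI)
  fix X assume X: "X \<subseteq> V"
  then have bound: "card (spanned E X) \<le> sum k X" by (rule hakimi_conditionD[OF hakimi])
  show "card (spanned E X) \<le> sum (k(a := k a - 1)) X"
  proof (cases "a \<in> X")
    case True
    have "finite X" using assms(1) X finite_subset by blast
    then have "sum k X = k a + sum k (X - {a})"
      "sum (k(a := k a - 1)) X = (k a - 1) + sum k (X - {a})"
      using True by (auto simp: sum.remove intro: sum.cong)
    moreover have "card (spanned E X) < sum k X"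
      using bound slack[OF X True] by (simp add: tight_def)
    ultimately show ?thesis by simp
  next
    case False
    then have "sum (k(a := k a - 1)) X = sum k X" by (intro sum.cong) auto
    then show ?thesis using bound by simp
  qed
qed

lemma card_spanned_insert:
  assumes "finite E" "e \<notin> E"
  shows "card (spanned (insert e E) X) = card (spanned E X) + (if e \<subseteq> X then 1 else 0)"
proof -
  have "spanned (insert e E) X = (if e \<subseteq> X then insert e (spanned E X) else spanned E X)"
    by (auto simp: spanned_def)
  then show ?thesis using assms by (auto simp: spanned_def)
qed

lemma hakimi_condition_insertD:
  assumes "finite E" "e \<notin> E" "hakimi_condition V (insert e E) k" "X \<subseteq> V"
  shows "card (spanned E X) + (if e \<subseteq> X then 1 else 0) \<le> sum k X"
  using hakimi_conditionD[OF assms(3,4)] unfolding card_spanned_insert[OF assms(1,2)] .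

lemma hakimi_condition_subset:
  assumes "finite E" "e \<notin> E" "hakimi_condition V (insert e E) k"
  shows "hakimi_condition V E k"
  unfolding hakimi_condition_def using add_leD1[OF hakimi_condition_insertD[OF assms]] by blast

lemma untight_element_exists:
  assumes "finite V" "finite E" "e \<notin> E" "e \<subseteq> V" "hakimi_condition V (insert e E) k"
  obtains a where "a \<in> e" "\<And>X. X \<subseteq> V \<Longrightarrow> a \<in> X \<Longrightarrow> \<not> tight E k X"
proof -
  note bound = hakimi_condition_insertD[OF assms(2,3,5)]
  have "\<exists>a\<in>e. \<forall>X\<subseteq>V. a \<in> X \<longrightarrow> \<not> tight E k X"
  proof (rule ccontr)
    assume "\<not> ?thesis"
    then have "\<And>a. a \<in> e \<Longrightarrow> \<exists>X\<subseteq>V. a \<in> X \<and> tight E k X" by blast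
    from tight_superset_exists[OF assms(2,1) hakimi_condition_subset[OF assms(2,3,5)]
        finite_subset[OF assms(4,1)] this]
    consider (empty) "e = {}" | (tight) X where "X \<subseteq> V" "e \<subseteq> X" "tight E k X" by blast
    then show False
    proof cases
      case empty
      then show False using bound[of "{}"] by simp
    next
      case tight
      then show False using bound[of X] by (simp add: tight_def)
    qed
  qed
  then show thesis using that by blast
qed

text \<open>Hakimi's criterion. An element of the next edge \<open>e\<close> can receive \<open>e\<close> unless it lies in a tight
  set. Tight sets being closed under union, some element does not: otherwise the whole of \<open>e\<close> would
  lie in one tight set, which would then span too many edges.\<close>

theorem edge_assignment_exists:
  assumes "finite V" "finite E" "\<And>e. e \<in> E \<Longrightarrow> e \<subseteq> V" "hakimi_condition V E k"
  shows "\<exists>h. (\<forall>e\<in>E. h e \<in> e) \<and> (\<forall>v\<in>V. card {e \<in> E. h e = v} \<le> k v)"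
  using assms(2-4)
proof (induction E arbitrary: k)
  case (insert e E)
  have "e \<subseteq> V" using insert.prems(1) by simp
  obtain a where a: "a \<in> e" "\<And>X. X \<subseteq> V \<Longrightarrow> a \<in> X \<Longrightarrow> \<not> tight E k X"
    using untight_element_exists[OF assms(1) insert.hyps \<open>e \<subseteq> V\<close> insert.prems(2)] by blast
  note hakimi = hakimi_condition_subset[OF insert.hyps insert.prems(2)]
  have "{a} \<subseteq> V" using a(1) \<open>e \<subseteq> V\<close> by blast
  then have "card (spanned E {a}) \<le> k a" "card (spanned E {a}) \<noteq> k a"
    using hakimi_conditionD[OF hakimi, of "{a}"] a(2)[of "{a}"] by (simp_all add: tight_def)
  then have "1 \<le> k a" by simp
  have "hakimi_condition V E (k(a := k a - 1))"
    using assms(1) hakimi a(2) by (rule hakimi_condition_decrease)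
  then have "\<exists>h. (\<forall>e\<in>E. h e \<in> e) \<and> (\<forall>v\<in>V. card {e \<in> E. h e = v} \<le> (k(a := k a - 1)) v)"
    by (rule insert.IH[rotated]) (simp add: insert.prems(1))
  then obtain h where h: "\<forall>e\<in>E. h e \<in> e" "\<forall>v\<in>V. card {e \<in> E. h e = v} \<le> (k(a := k a - 1)) v"
    by blast
  have "card {d \<in> insert e E. (h(e := a)) d = v} \<le> k v" if "v \<in> V" for v
  proof -
    have "{d \<in> insert e E. (h(e := a)) d = v}
        = (if v = a then insert e {d \<in> E. h d = v} else {d \<in> E. h d = v})"
      using insert.hyps(2) by auto
    then show ?thesis using bspec[OF h(2) that] insert.hyps \<open>1 \<le> k a\<close> by (auto split: if_splits)
  qed
  moreover have "\<forall>d\<in>insert e E. (h(e := a)) d \<in> d" using h(1) a(1) by auto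
  ultimately show ?case by blast
qed simp

section \<open>Choosability\<close>

lemma adaptably_choosable_of_assignment:
  assumes simple: "simple_graph V E"
    and h: "\<forall>e\<in>E. h e \<in> e" "\<forall>v\<in>V. card {e \<in> E. h e = v} \<le> k"
  shows "adaptably_choosable V E (Suc k)"
  unfolding adaptably_choosable_def
proof (intro allI impI)
  fix F :: "'a set \<Rightarrow> int" and L :: "'a \<Rightarrow> int set"
  assume L: "\<forall>v\<in>V. finite (L v) \<and> Suc k \<le> card (L v)"
  have "\<exists>x. x \<in> L v \<and> x \<notin> F ` {e \<in> E. h e = v}" if v: "v \<in> V" for v
  proof (rule ccontr)
    assume "\<not> ?thesis"
    then have "L v \<subseteq> F ` {e \<in> E. h e = v}" by auto
    then have "card (L v) \<le> card {e \<in> E. h e = v}"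
      by (rule surj_card_le[rotated]) (simp add: simple_graph_finite(2)[OF simple])
    then show False using h(2) L v by fastforce
  qed
  then obtain c where c: "\<And>v. v \<in> V \<Longrightarrow> c v \<in> L v \<and> c v \<notin> F ` {e \<in> E. h e = v}" by metis
  have "adapted E F c"
    unfolding adapted_def
  proof (intro allI impI notI)
    fix u v assume e: "{u, v} \<in> E" and eq: "c u = F {u, v} \<and> c v = F {u, v}"
    have "u \<in> V" "v \<in> V" using simple_graph_edge_subset[OF simple e] by auto
    moreover have "h {u, v} = u \<or> h {u, v} = v" using h(1) e by auto
    ultimately show False using c[of u] c[of v] e eq by auto
  qed
  then show "\<exists>c. adapted E F c \<and> (\<forall>v\<in>V. c v \<in> L v)" using c by auto
qed

theorem adaptably_choosable_of_edge_bound: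
  assumes simple: "simple_graph V E"
    and bound: "\<And>X. X \<subseteq> V \<Longrightarrow> X \<noteq> {} \<Longrightarrow> card (spanned E X) \<le> k * card X"
  shows "adaptably_choosable V E (Suc k)"
proof -
  have "hakimi_condition V E (\<lambda>_. k)"
    unfolding hakimi_condition_def
  proof (intro allI impI)
    fix X assume "X \<subseteq> V"
    moreover have "spanned E {} = {}"
      using simple_graph_card_edge[OF simple] by (force simp: spanned_def)
    ultimately show "card (spanned E X) \<le> (\<Sum>v\<in>X. k)"
      using bound[of X] by (cases "X = {}") (simp_all add: mult.commute)
  qed
  with simple_graph_finite[OF simple] simple_graph_edge_subset[OF simple]
  have "\<exists>h. (\<forall>e\<in>E. h e \<in> e) \<and> (\<forall>v\<in>V. card {e \<in> E. h e = v} \<le> k)"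
    by (rule edge_assignment_exists)
  then show ?thesis using adaptably_choosable_of_assignment[OF simple] by blast
qed

text \<open>An edge whose ends have intersecting lists is coloured with the only common element.\<close>

lemma kd_choosable_of_adaptably_choosable:
  assumes simple: "simple_graph V E" and adaptable: "adaptably_choosable V E k"
  shows "kd_choosable V E k 1"
  unfolding kd_choosable_def
proof (intro allI impI)
  fix L assume L: "kd_list_assignment V E k 1 L"
  define F where "F e = (SOME x. \<forall>v\<in>e. x \<in> L v)" for e
  have lists: "\<forall>v\<in>V. finite (L v) \<and> k \<le> card (L v)" using L by (simp add: kd_list_assignment_def)
  then obtain c where c: "adapted E F c" "\<forall>v\<in>V. c v \<in> L v"
    using adaptable unfolding adaptably_choosable_def by metis
  have "proper_colouring E c"
    unfolding proper_colouring_def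
  proof (intro allI impI notI)
    fix u v assume e: "{u, v} \<in> E" and eq: "c u = c v"
    have V: "u \<in> V" "v \<in> V" using simple_graph_edge_subset[OF simple e] by auto
    then have common: "\<forall>w\<in>{u, v}. c u \<in> L w" using c(2) eq by auto
    then have "\<forall>w\<in>{u, v}. F {u, v} \<in> L w" unfolding F_def by (rule someI)
    moreover have "card (L u \<inter> L v) \<le> 1" using L e by (simp add: kd_list_assignment_def)
    ultimately have "c u = F {u, v}" using common lists V
      by (metis Int_iff One_nat_def card_le_Suc0_iff_eq finite_Int insertCI)
    then show False using c(1) e eq unfolding adapted_def by metis
  qed
  then show "\<exists>c. proper_colouring E c \<and> (\<forall>v\<in>V. c v \<in> L v)" using c by auto
qed

theorem theorem3:
  fixes V :: "'a set" and E :: "'a set set"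
  assumes "simple_graph V E"
    and "planar_graph V E"
    and "\<forall>T1 T2. triangle V E T1 \<and> triangle V E T2 \<and> T1 \<noteq> T2 \<longrightarrow>
                   \<not> intersecting_cycles T1 T2"
    and "\<forall>T. triangle V E T \<longrightarrow>
              card {Q. is_cycle V E 4 Q \<and> adjacent_cycles T Q} \<le> 1"
  shows "adaptably_choosable V E 3 \<and> kd_choosable V E 3 1"
proof -
  have sparse: "triangle_sparse V E" using assms(3,4) by (simp add: triangle_sparse_def)
  have "card (spanned E X) \<le> 2 * card X" if X: "X \<subseteq> V" "X \<noteq> {}" for X
  proof -
    have sub: "spanned E X \<subseteq> E" "\<Union>(spanned E X) \<subseteq> X" by (auto simp: spanned_def)
    have "card (spanned E X) + 2 \<le> 2 * card X"
      using simple_graph_spanned[OF assms(1) X(1)] planar_graph_mono[OF assms(2) X(1) sub]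
        triangle_sparse_mono[OF sparse assms(1) X(1) sub(1)] X(2)
      by (rule planar_triangle_sparse_edge_bound)
    then show ?thesis by simp
  qed
  then have "adaptably_choosable V E (Suc 2)"
    by (rule adaptably_choosable_of_edge_bound[OF assms(1)])
  then have "adaptably_choosable V E 3" by (simp add: numeral_3_eq_3)
  then show ?thesis using kd_choosable_of_adaptably_choosable[OF assms(1)] by simp
qed

end
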